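(* Let $Y_1^\hbar,Y_2^\hbar,Y_3^\hbar$ be Hermitian operators with $[Y^\hbar_i,Y^\hbar_{i+1}]=i\pi\hbar\{Y_i,Y_{i+1}\}=i\pi\hbar$ for $i=1,2,3$ (indices mod 3), and let $q\equiv e^{-i\pi\hbar}$. Since the commutators are numbers, $\exp(aY_i^\hbar)\exp(bY_j^\hbar)=\exp\left(aY_i^\hbar+bY_j^\hbar+\frac{ab}{2}[Y_i^\hbar,Y_j^\hbar]\right)$ for any constants $a,b$, and one has the Weyl ordering $$e^{Y^\hbar_1+Y^\hbar_2}=q^{1/2}e^{Y^\hbar_1}e^{Y^\hbar_2}=q^{-1/2}e^{Y^\hbar_2}e^{Y^\hbar_1}.$$ Let the central elements $G_1,G_2,G_3$ remain central and non-deformed, and let $$G^\hbar_{1,2}=e^{Y^\hbar_1+Y^\hbar_2}+e^{-Y^\hbar_1-Y^\hbar_2}+e^{-Y^\hbar_1+Y^\hbar_2}+G_1e^{Y^\hbar_2}+G_2e^{-Y^\hbar_1},$$ $$G^\hbar_{2,3}=e^{Y^\hbar_2+Y^\hbar_3}+e^{-Y^\hbar_2-Y^\hbar_3}+e^{-Y^\hbar_2+Y^\hbar_3}+G_2e^{Y^\hbar_3}+G_3e^{-Y^\hbar_2},$$ $$G^\hbar_{1,3}=e^{Y^\hbar_3+Y^\hbar_1}+e^{-Y^\hbar_3-Y^\hbar_1}+e^{-Y^\hbar_3+Y^\hbar_1}+G_3e^{Y^\hbar_1}+G_1e^{-Y^\hbar_3},$$ so that $(G^\hbar_{i,j})^\dagger=G^\hbar_{i,j}$.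 Then: (1) The operators $G^\hbar_{i,j}$ satisfy the commutation relations $$q^{-1/2}G^\hbar_{1,2}G^\hbar_{2,3}-q^{1/2}G^\hbar_{2,3}G^\hbar_{1,2}=(q^{-1}-q)G^\hbar_{1,3}+(q^{-1/2}-q^{1/2})\omega_{1,3},$$ $$q^{-1/2}G^\hbar_{2,3}G^\hbar_{1,3}-q^{1/2}G^\hbar_{1,3}G^\hbar_{2,3}=(q^{-1}-q)G^\hbar_{1,2}+(q^{-1/2}-q^{1/2})\omega_{1,2},$$ $$q^{-1/2}G^\hbar_{1,3}G^\hbar_{1,2}-q^{1/2}G^\hbar_{1,2}G^\hbar_{1,3}=(q^{-1}-q)G^\hbar_{2,3}+(q^{-1/2}-q^{1/2})\omega_{2,3}.$$ (2) The action of the quantum braid group on the $G^\hbar_{i,j}$ and $\omega_{i,j}$ is given by $$\beta_{1,2}G^\hbar_{1,2}=G^\hbar_{1,2},\qquad \beta_{1,2}G^\hbar_{2,3}=G^\hbar_{1,3},$$ $$\beta_{1,2}G^\hbar_{1,3}=q^{1/2}G^\hbar_{1,2}G^\hbar_{1,3}-qG^\hbar_{2,3}-q^{1/2}\omega_{2,3}=q^{-1/2}G^\hbar_{1,3}G^\hbar_{1,2}-q^{-1}G^\hbar_{2,3}-q^{-1/2}\omega_{2,3},$$ $$\beta_{1,2}\omega_{1,2}=\omega_{1,2},\qquad \beta_{1,2}\omega_{2,3}=\omega_{1,3},\qquad \beta_{1,2}\omega_{1,3}=\omega_{2,3},$$ and $$\beta_{2,3}G^\hbar_{1,2}=q^{1/2}G^\hbar_{2,3}G^\hbar_{1,2}-qG^\hbar_{1,3}-q^{1/2}\omega_{1,3}=q^{-1/2}G^\hbar_{1,2}G^\hbar_{2,3}-q^{-1}G^\hbar_{1,3}-q^{-1/2}\omega_{1,3},$$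 $$\beta_{2,3}G^\hbar_{2,3}=G^\hbar_{2,3},\qquad \beta_{2,3}G^\hbar_{1,3}=G^\hbar_{1,2},$$ $$\beta_{2,3}\omega_{1,2}=\omega_{1,3},\qquad \beta_{2,3}\omega_{2,3}=\omega_{2,3},\qquad \beta_{2,3}\omega_{1,3}=\omega_{1,2},$$ and it satisfies $(\beta_{1,2}\beta_{2,3})^3=\mathrm{Id}$. (3) The quantum central element is $$\mathcal C^\hbar=q^{-1/2}G^\hbar_{1,2}G^\hbar_{2,3}G^\hbar_{1,3}-q^{-1}(G^\hbar_{1,2})^2-q(G^\hbar_{2,3})^2-q^{-1}(G^\hbar_{1,3})^2-q^{-1/2}\omega_{1,2}G^\hbar_{1,2}-q^{1/2}\omega_{2,3}G^\hbar_{2,3}-q^{-1/2}\omega_{1,3}G^\hbar_{1,3},$$ and it is Hermitian: $(\mathcal C^\hbar)^\dagger=\mathcal C^\hbar$.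
   Context: $Y_1,Y_2,Y_3$ are the (suitably shifted) shear coordinates on the Teichmüller space of a sphere with four holes/orbifold points, with Poisson brackets $\{Y_1,Y_2\}=\{Y_2,Y_3\}=\{Y_3,Y_1\}=1$; $Y_i^\hbar$ are the corresponding quantum operators. $G_i=e^{P_i/2}+e^{-P_i/2}$ for a hole of perimeter $P_i$, and $G_i=2\cos(2\pi/k_i)$ for an orbifold point of order $k_i$. The operators $G^\hbar_{i,j}$ are obtained from the classical geodesic functions $G_{i,j}$ of closed geodesics around the $i$-th and $j$-th holes/orbifold points by substituting $Y_i^\hbar$ for $Y_i$. The elements $\omega_{i,j}=G_iG_j+G_kG_\infty$, $\{i,j,k\}=\{1,2,3\}$, are central, where $G_\infty=e^{Y_1+Y_2+Y_3}+e^{-Y_1-Y_2-Y_3}$ (with $Y_i^\hbar$ in place of $Y_i$ in the quantum case) is the central element corresponding to the geodesic around the fourth hole. The braid-group generator $\beta_{i,i+1}$ interchanges the $i$-th and $(i+1)$-th holes/orbifold points. $\dagger$ denotes the Hermitian adjoint, and $q^{\pm1/2}=e^{\mp i\pi\hbar/2}$.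
   Formalization: In (1)–(3) q is read as e^{iπħ}: with q=e^{-iπħ} and [Y_i,Y_{i+1}]=iπħ the term e^{Y_1+2Y_2+Y_3} does not cancel in (1). The Weyl ordering keeps its printed values q^{±1/2}=e^{∓iπħ/2}; exp is the convergent series on a common invariant domain. *)

theory Defs
  imports "HOL-Analysis.Analysis" "HOL-Library.Function_Algebras"
begin

class scaleC =
  fixes scaleC :: "complex \<Rightarrow> 'a \<Rightarrow> 'a"  (infixr \<open>*\<^sub>C\<close> 75)

text \<open>
  Complex pre-Hilbert spaces; the norm and topology are those of the real part of the inner
  product.  As the operators \<open>Y\<^sub>i\<close> are necessarily unbounded, a type of this class plays the
  role of their common invariant domain, which is dense in its completion.
\<close>
class complex_inner = real_inner + scaleC +
  fixes cinner :: "'a \<Rightarrow> 'a \<Rightarrow> complex"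
  assumes scaleC_add_right: "a *\<^sub>C (x + y) = a *\<^sub>C x + a *\<^sub>C y"
    and scaleC_add_left: "(a + b) *\<^sub>C x = a *\<^sub>C x + b *\<^sub>C x"
    and scaleC_scaleC: "a *\<^sub>C b *\<^sub>C x = (a * b) *\<^sub>C x"
    and scaleC_one: "1 *\<^sub>C x = x"
    and scaleR_scaleC: "r *\<^sub>R x = complex_of_real r *\<^sub>C x"
    and cinner_commute: "cinner x y = cnj (cinner y x)"
    and cinner_add_right: "cinner x (y + z) = cinner x y + cinner x z"
    and cinner_scaleC_right: "cinner x (a *\<^sub>C y) = a * cinner x y"
    and inner_Re_cinner: "inner x y = Re (cinner x y)"

lemma vector_space_scaleC: "vector_space (scaleC :: complex \<Rightarrow> 'a::complex_inner \<Rightarrow> 'a)"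
  by unfold_locales (rule scaleC_add_right scaleC_add_left scaleC_scaleC scaleC_one)+

lemma clinear_iff:
  "Vector_Spaces.linear scaleC scaleC f \<longleftrightarrow>
    (\<forall>x y. f (x + y) = f x + f y) \<and> (\<forall>c x. f (c *\<^sub>C x) = c *\<^sub>C f x)"
  for f :: "'a::complex_inner \<Rightarrow> 'a"
  unfolding Vector_Spaces.linear_def module_hom_def module_hom_axioms_def
  using vector_space_scaleC[where 'a = 'a]
  by (simp only: vector_space_def module_def simp_thms)

lemma scaleC_zero_right: "c *\<^sub>C (0 :: 'a::complex_inner) = 0"
  using scaleC_add_right[of c 0 0] by simp

lemma scaleC_minus_right: "c *\<^sub>C (- x :: 'a::complex_inner) = - (c *\<^sub>C x)"
proof -
  have "c *\<^sub>C x + c *\<^sub>C (- x) = 0"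
    by (simp add: scaleC_zero_right flip: scaleC_add_right)
  then show ?thesis
    by (rule minus_unique[symmetric])
qed

lemma scaleC_diff_right: "c *\<^sub>C (x - y :: 'a::complex_inner) = c *\<^sub>C x - c *\<^sub>C y"
  using scaleC_add_right[of c x "- y"] by (simp add: scaleC_minus_right)

lemma scaleC_commute: "a *\<^sub>C b *\<^sub>C x = b *\<^sub>C a *\<^sub>C (x :: 'a::complex_inner)"
  by (simp only: scaleC_scaleC mult.commute)

typedef (overloaded) 'd operator =
  "{f :: 'd::complex_inner \<Rightarrow> 'd. Vector_Spaces.linear scaleC scaleC f}"
  morphisms apply_op Op
  by (rule exI[of _ "\<lambda>x. x"]) (simp add: clinear_iff)

lemma apply_op_add: "apply_op A (x + y) = apply_op A x + apply_op A y"
  and apply_op_scaleC: "apply_op A (c *\<^sub>C x) = c *\<^sub>C apply_op A x"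
  using apply_op[of A] by (simp_all add: clinear_iff)

lemma operator_eqI: "(\<And>x. apply_op A x = apply_op B x) \<Longrightarrow> A = B"
  using apply_op_inject[of A B] by blast

lemma apply_op_Op:
  assumes "\<And>x y. f (x + y) = f x + f y" and "\<And>c x. f (c *\<^sub>C x) = c *\<^sub>C f x"
  shows "apply_op (Op f) x = f x"
  using assms by (simp add: Op_inverse clinear_iff)

instantiation operator :: (complex_inner) "{ring, monoid_mult, scaleC}"
begin

definition "0 = Op (\<lambda>x. 0)"
definition "1 = Op (\<lambda>x. x)"
definition "A + B = Op (\<lambda>x. apply_op A x + apply_op B x)"
definition "- A = Op (\<lambda>x. - apply_op A x)"
definition "A - B = Op (\<lambda>x. apply_op A x - apply_op B x)"
definition "A * B = Op (\<lambda>x. apply_op A (apply_op B x))"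
definition "c *\<^sub>C A = Op (\<lambda>x. c *\<^sub>C apply_op A x)"

lemma apply_op_simps [simp]:
  "apply_op 0 x = (0 :: 'a)"
  "apply_op 1 x = x"
  "apply_op (A + B) x = apply_op A x + apply_op B x"
  "apply_op (- A) x = - apply_op A x"
  "apply_op (A - B) x = apply_op A x - apply_op B x"
  "apply_op (A * B) x = apply_op A (apply_op B x)"
  "apply_op (c *\<^sub>C A) x = c *\<^sub>C apply_op A x"
  unfolding zero_operator_def one_operator_def plus_operator_def uminus_operator_def
    minus_operator_def times_operator_def scaleC_operator_def
  by (subst apply_op_Op;
      simp add: apply_op_add apply_op_scaleC scaleC_add_right scaleC_diff_right
        scaleC_minus_right scaleC_zero_right scaleC_commute)+

instance
  by standard (rule operator_eqI; simp add: apply_op_add algebra_simps)+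

end

instantiation "fun" :: (type, scaleC) scaleC
begin
definition "c *\<^sub>C f = (\<lambda>x. c *\<^sub>C f x)"
instance ..
end

definition hermitian :: "'d::complex_inner operator \<Rightarrow> bool" where
  "hermitian A \<longleftrightarrow> (\<forall>x y. cinner (apply_op A x) y = cinner x (apply_op A y))"

definition exp_summable :: "'d::complex_inner operator \<Rightarrow> bool" where
  "exp_summable A \<longleftrightarrow> (\<forall>x. summable (\<lambda>n. apply_op (A ^ n) x /\<^sub>R fact n))"

text \<open>Only meaningful if \<^term>\<open>exp_summable A\<close>.\<close>
definition op_exp :: "'d::complex_inner operator \<Rightarrow> 'd operator" where
  "op_exp A = Op (\<lambda>x. \<Sum>n. apply_op (A ^ n) x /\<^sub>R fact n)"

record (overloaded) ('d::complex_inner) shear_data =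
  Y1 :: "'d operator"
  Y2 :: "'d operator"
  Y3 :: "'d operator"
  G1 :: "'d operator"
  G2 :: "'d operator"
  G3 :: "'d operator"

text \<open>
  The quantum shear coordinates together with the central elements \<open>G\<^sub>i\<close>.  Summability
  says that the domain consists of entire vectors and is invariant under the exponentials.
  For \<open>h \<noteq> 0\<close> an instance is given by \<open>Y\<^sub>1 = x\<close>, \<open>Y\<^sub>2 = - \<i>\<pi>h d/dx\<close>, \<open>Y\<^sub>3 = - Y\<^sub>1 - Y\<^sub>2\<close> on the
  span of the functions \<open>x\<^sup>n exp (\<lambda>x - x\<^sup>2/2)\<close> with \<open>\<lambda>\<close> complex, in \<open>L\<^sup>2\<close> of the real line.
  Real scalars are a special case of the \<open>G\<^sub>i\<close>, in particular \<open>2 cosh (P\<^sub>i/2)\<close> (hole) and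
  \<open>2 cos (2\<pi>/k\<^sub>i)\<close> (orbifold point).
\<close>
definition quantum_shear :: "real \<Rightarrow> 'd::complex_inner shear_data set" where
  "quantum_shear h = {d.
     hermitian (Y1 d) \<and> hermitian (Y2 d) \<and> hermitian (Y3 d) \<and>
     Y1 d * Y2 d - Y2 d * Y1 d = (\<i> * pi * h) *\<^sub>C 1 \<and>
     Y2 d * Y3 d - Y3 d * Y2 d = (\<i> * pi * h) *\<^sub>C 1 \<and>
     Y3 d * Y1 d - Y1 d * Y3 d = (\<i> * pi * h) *\<^sub>C 1 \<and>
     (\<forall>a0 a1 a2 a3. exp_summable (a0 *\<^sub>C 1 + a1 *\<^sub>C Y1 d + a2 *\<^sub>C Y2 d + a3 *\<^sub>C Y3 d)) \<and>
     (\<forall>G \<in> {G1 d, G2 d, G3 d}. hermitian G \<and>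
        (\<forall>A \<in> {Y1 d, Y2 d, Y3 d, G1 d, G2 d, G3 d}. G * A = A * G))}"

definition G12 :: "'d::complex_inner shear_data \<Rightarrow> 'd operator" where
  "G12 d = op_exp (Y1 d + Y2 d) + op_exp (- Y1 d - Y2 d) + op_exp (- Y1 d + Y2 d)
     + G1 d * op_exp (Y2 d) + G2 d * op_exp (- Y1 d)"

definition G23 :: "'d::complex_inner shear_data \<Rightarrow> 'd operator" where
  "G23 d = op_exp (Y2 d + Y3 d) + op_exp (- Y2 d - Y3 d) + op_exp (- Y2 d + Y3 d)
     + G2 d * op_exp (Y3 d) + G3 d * op_exp (- Y2 d)"

definition G13 :: "'d::complex_inner shear_data \<Rightarrow> 'd operator" where
  "G13 d = op_exp (Y3 d + Y1 d) + op_exp (- Y3 d - Y1 d) + op_exp (- Y3 d + Y1 d)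
     + G3 d * op_exp (Y1 d) + G1 d * op_exp (- Y3 d)"

definition Ginf :: "'d::complex_inner shear_data \<Rightarrow> 'd operator" where
  "Ginf d = op_exp (Y1 d + Y2 d + Y3 d) + op_exp (- Y1 d - Y2 d - Y3 d)"

definition omega12 :: "'d::complex_inner shear_data \<Rightarrow> 'd operator" where
  "omega12 d = G1 d * G2 d + G3 d * Ginf d"

definition omega23 :: "'d::complex_inner shear_data \<Rightarrow> 'd operator" where
  "omega23 d = G2 d * G3 d + G1 d * Ginf d"

definition omega13 :: "'d::complex_inner shear_data \<Rightarrow> 'd operator" where
  "omega13 d = G1 d * G3 d + G2 d * Ginf d"

text \<open>
  \<open>q_pow h s\<close> is the power \<open>q\<^sup>s\<close> of \<open>q = exp (\<i>\<pi>h)\<close>.  The sign in the exponent is forced by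
  \<open>[Y\<^sub>i, Y\<^sub>i\<^sub>+\<^sub>1] = \<i>\<pi>h\<close> and the form of the commutation relations of the \<open>G\<^sub>i\<^sub>j\<close>:
  \<open>exp (Y\<^sub>1 + Y\<^sub>2) exp (Y\<^sub>2 + Y\<^sub>3) = exp (\<i>\<pi>h/2) exp (Y\<^sub>1 + 2Y\<^sub>2 + Y\<^sub>3)\<close>, and the last term
  has to cancel in \<open>q\<^sup>-\<^sup>1\<^sup>/\<^sup>2 G\<^sub>1\<^sub>2 G\<^sub>2\<^sub>3 - q\<^sup>1\<^sup>/\<^sup>2 G\<^sub>2\<^sub>3 G\<^sub>1\<^sub>2\<close>.  With the
  opposite sign, \<open>q = exp (- \<i>\<pi>h)\<close>, one would need \<open>[Y\<^sub>i, Y\<^sub>i\<^sub>+\<^sub>1] = - \<i>\<pi>h\<close>, which is the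
  same up to replacing \<open>h\<close> by \<open>- h\<close>.
\<close>
definition q_pow :: "real \<Rightarrow> real \<Rightarrow> complex" where
  "q_pow h s = exp (\<i> * pi * h * s)"

definition casimir :: "real \<Rightarrow> 'd::complex_inner shear_data \<Rightarrow> 'd operator" where
  "casimir h d =
     q_pow h (- 1/2) *\<^sub>C (G12 d * G23 d * G13 d)
     - q_pow h (- 1) *\<^sub>C (G12 d ^ 2) - q_pow h 1 *\<^sub>C (G23 d ^ 2) - q_pow h (- 1) *\<^sub>C (G13 d ^ 2)
     - q_pow h (- 1/2) *\<^sub>C (omega12 d * G12 d) - q_pow h (1/2) *\<^sub>C (omega23 d * G23 d)
     - q_pow h (- 1/2) *\<^sub>C (omega13 d * G13 d)"

text \<open>
  The braid group exchanges the \<open>G\<^sub>i\<close>, so it acts on observables as functions of the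
  coordinates \<open>(Y, G)\<close> and not on the operators at a single value of \<open>(Y, G)\<close>, where the
  \<open>G\<^sub>i\<close> may be distinct numbers.  An observable is an operator-valued function on
  \<^term>\<open>quantum_shear h\<close>, extended by zero, with pointwise operations; its
  unit is \<open>obs h 1\<close>.
\<close>
definition obs ::
    "real \<Rightarrow> ('d::complex_inner shear_data \<Rightarrow> 'd operator) \<Rightarrow> 'd shear_data \<Rightarrow> 'd operator" where
  "obs h F = (\<lambda>d. if d \<in> quantum_shear h then F d else 0)"

inductive_set generated_algebra :: "'a \<Rightarrow> 'a set \<Rightarrow> 'a::{plus, times, scaleC} set"
  for u :: 'a and S :: "'a set" where
  unit: "u \<in> generated_algebra u S"
| generator: "x \<in> S \<Longrightarrow> x \<in> generated_algebra u S"
| add: "x \<in> generated_algebra u S \<Longrightarrow> y \<in> generated_algebra u S \<Longrightarrow> x + y \<in> generated_algebra u S"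
| mult: "x \<in> generated_algebra u S \<Longrightarrow> y \<in> generated_algebra u S \<Longrightarrow> x * y \<in> generated_algebra u S"
| scale: "x \<in> generated_algebra u S \<Longrightarrow> c *\<^sub>C x \<in> generated_algebra u S"

definition geodesic_algebra ::
    "real \<Rightarrow> ('d::complex_inner shear_data \<Rightarrow> 'd operator) set" where
  "geodesic_algebra h =
     generated_algebra (obs h 1) (obs h ` {G12, G23, G13, G1, G2, G3, Ginf})"

definition algebra_automorphism ::
    "'a \<Rightarrow> 'a::{plus, times, scaleC} set \<Rightarrow> ('a \<Rightarrow> 'a) \<Rightarrow> bool" where
  "algebra_automorphism u A \<beta> \<longleftrightarrow>
     bij_betw \<beta> A A \<and> \<beta> u = u \<and>
     (\<forall>x \<in> A. \<forall>y \<in> A. \<beta> (x + y) = \<beta> x + \<beta> y \<and> \<beta> (x * y) = \<beta> x * \<beta> y) \<and>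
     (\<forall>x \<in> A. \<forall>c. \<beta> (c *\<^sub>C x) = c *\<^sub>C \<beta> x)"

end

theory Submission
  imports Defs
begin

text \<open>
  Since the domain is not complete and the \<open>Y\<^sub>i\<close> are unbounded, the product formula for exponentials
  is proved weakly: paired with a vector, both sides are absolutely convergent double series,
  which are regrouped by total degree.

  The braid generators do not come from maps of the shear coordinates within the given domain, so
  well-definedness has to be extracted from a presentation: the three commutation relations and the
  identity expressing the Casimir element through the central \<open>G\<^sub>i\<close>, \<open>G\<^sub>\<infinity>\<close> reduce every element to a
  combination of ordered monomials containing \<open>G\<^sub>\<infinity>\<close> at most linearly, and these are linearly
  independent observables.  For independence, move along the curve \<open>Y\<^sub>i + t w\<^sub>i\<close>,
  \<open>G\<^sub>i = exp (t w\<^sub>i\<^sub>+\<^sub>3)\<close>: with generic \<open>w\<close>, distinct monomials have distinct growth rates.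
  The images of the generators satisfy the same relations, so the graph of a braid generator,
  a subalgebra of pairs of observables, is spanned by pairs of monomials and hence is
  single-valued.  Bijectivity follows from \<open>\<beta>\<^sub>1\<^sub>2\<beta>\<^sub>2\<^sub>3\<close> being the cyclic rotation of the generators.
\<close>

section \<open>Operators and their exponentials\<close>

text \<open>Absolute convergence in the product formula comes from entire vectors on both sides: the
  adjoint carries the powers of \<open>A\<close> to the left vector, so the double series is
  dominated by a product of two norm-convergent ones. No continuity of the operators is available;
  an unbounded operator is moved past an infinite sum by passing to its adjoint.

  The Casimir relation is a quantum Fricke cubic. It is quadratic in \<open>Ginf\<close>, which is
  why first powers of \<open>Ginf\<close> suffice. Growth rates see the same relation: the square of
  \<open>Ginf\<close> and the product of \<open>G12\<close>, \<open>G23\<close>, \<open>G13\<close>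
  grow equally fast, and only the parity of the exponent of \<open>Ginf\<close> separates the
  remaining monomials.

  \<open>h\<close> is arbitrary, so \<open>q\<close> may be 1 or another root of unity and
  differences of powers of \<open>q\<close> must not be divided by. At \<open>h = 0\<close> the
  omega terms drop out of the commutation relations, so the central elements cannot be recovered
  from them; the cubic relation enters as an independent input.\<close>

class complex_algebra = ring + monoid_mult + scaleC +
  assumes cscale_add: "a *\<^sub>C (x + y) = a *\<^sub>C x + a *\<^sub>C y"
    and add_cscale: "(a + b) *\<^sub>C x = a *\<^sub>C x + b *\<^sub>C x"
    and cscale_cscale: "a *\<^sub>C b *\<^sub>C x = (a * b) *\<^sub>C x"
    and cscale_one: "1 *\<^sub>C x = x"
    and cscale_mult_left: "(a *\<^sub>C x) * y = a *\<^sub>C (x * y)"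
    and cscale_mult_right: "x * (a *\<^sub>C y) = a *\<^sub>C (x * y)"

text \<open>\<open>ring_1\<close> would demand \<open>0 \<noteq> 1\<close>, which fails for
  operators on the zero space. The weaker class passes to pointwise function algebras, hence to
  observables and to pairs of them.\<close>

instance operator :: (complex_inner) complex_algebra
  by standard
    (rule operator_eqI; simp add: apply_op_add apply_op_scaleC scaleC_add_right scaleC_add_left
      scaleC_scaleC scaleC_one)+

lemma scaleC_fun_apply [simp]: "(c *\<^sub>C f) x = c *\<^sub>C f x"
  by (simp add: scaleC_fun_def)

instance "fun" :: (type, complex_algebra) complex_algebra
  by standard (simp_all add: fun_eq_iff algebra_simps cscale_add add_cscale cscale_cscale cscale_one
      cscale_mult_left cscale_mult_right)

lemma vector_space_cscale: "vector_space (scaleC :: complex \<Rightarrow> 'a::complex_algebra \<Rightarrow> 'a)"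
  by unfold_locales (rule cscale_add add_cscale cscale_cscale cscale_one)+

interpretation cvs: vector_space "scaleC :: complex \<Rightarrow> 'a::complex_algebra \<Rightarrow> 'a"
  by (rule vector_space_cscale)

lemma fun_power_apply: "(f ^ n) x = f x ^ n" for f :: "'a \<Rightarrow> 'b::monoid_mult"
  by (induction n) simp_all

lemma fun_sum_apply: "sum f A x = (\<Sum>i\<in>A. f i x)" for f :: "'i \<Rightarrow> 'a \<Rightarrow> 'b::comm_monoid_add"
  by (induction A rule: infinite_finite_induct) simp_all

lemma cscale_minus_left: "(- c) *\<^sub>C x = - (c *\<^sub>C (x :: 'a::complex_algebra))"
  by (rule cvs.scale_minus_left)

section \<open>Bounds for the complex inner product\<close>

lemma cinner_add_left: "cinner (x + y) z = cinner x z + cinner y (z :: 'a::complex_inner)"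
  by (metis cinner_add_right cinner_commute complex_cnj_add)

lemma cinner_scaleC_left: "cinner (a *\<^sub>C x) y = cnj a * cinner x (y :: 'a::complex_inner)"
  by (metis cinner_scaleC_right cinner_commute complex_cnj_mult)

lemma cinner_zero_right [simp]: "cinner x (0 :: 'a::complex_inner) = 0"
  using cinner_add_right[of x 0 0] by simp

lemma cinner_minus_right: "cinner x (- y) = - cinner x (y :: 'a::complex_inner)"
  using cinner_add_right[of x y "- y"] by (simp add: eq_neg_iff_add_eq_0 add.commute)

lemma cinner_diff_right: "cinner x (y - z) = cinner x y - cinner x (z :: 'a::complex_inner)"
  using cinner_add_right[of x y "- z"] by (simp add: cinner_minus_right)

lemma cinner_eqI:
  fixes x y :: "'a::complex_inner"
  assumes "\<And>z. cinner z x = cinner z y"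
  shows "x = y"
proof -
  have "cinner (x - y) (x - y) = 0"
    using assms by (simp add: cinner_diff_right)
  then have "inner (x - y) (x - y) = 0"
    by (simp add: inner_Re_cinner)
  then show ?thesis by simp
qed

text \<open>The real and imaginary parts are real inner products with \<open>y\<close> and a rotated
  copy of \<open>y\<close>. Real Cauchy-Schwarz for each gives the factor 2, harmless for
  summability.\<close>

lemma cinner_norm_le: "norm (cinner x y) \<le> 2 * norm x * norm (y :: 'a::complex_inner)"
proof -
  let ?z = "(- \<i>) *\<^sub>C y"
  have "norm ?z = norm y"
    by (simp add: norm_eq_sqrt_inner inner_Re_cinner cinner_scaleC_left cinner_scaleC_right)
  moreover have "Im (cinner x y) = inner x ?z"
    by (simp add: inner_Re_cinner cinner_scaleC_right)
  moreover have "Re (cinner x y) = inner x y"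
    by (simp add: inner_Re_cinner)
  ultimately have "\<bar>Re (cinner x y)\<bar> \<le> norm x * norm y" "\<bar>Im (cinner x y)\<bar> \<le> norm x * norm y"
    by (metis Cauchy_Schwarz_ineq2)+
  then show ?thesis
    using cmod_le[of "cinner x y"] by linarith
qed

lemma bounded_linear_cinner: "bounded_linear (cinner (x :: 'a::complex_inner))"
  by (rule bounded_linear_intro[where K = "2 * norm x"])
    (use cinner_norm_le[of x] in \<open>auto simp: cinner_add_right scaleR_scaleC cinner_scaleC_right
      scaleR_conv_of_real mult_ac\<close>)

lemma norm_scaleC: "norm (c *\<^sub>C x) = norm c * norm (x :: 'a::complex_inner)"
proof -
  have "cinner (c *\<^sub>C x) (c *\<^sub>C x) = complex_of_real ((norm c)\<^sup>2) * cinner x x"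
    unfolding complex_norm_square by (simp add: cinner_scaleC_left cinner_scaleC_right)
  then have "inner (c *\<^sub>C x) (c *\<^sub>C x) = (norm c)\<^sup>2 * inner x x"
    by (simp add: inner_Re_cinner del: of_real_power)
  then show ?thesis
    by (simp add: norm_eq_sqrt_inner real_sqrt_mult)
qed

lemma bounded_linear_scaleC: "bounded_linear (\<lambda>x :: 'a::complex_inner. c *\<^sub>C x)"
  by (rule bounded_linear_intro[where K = "norm c"])
    (simp_all add: scaleC_add_right scaleR_scaleC scaleC_commute norm_scaleC)

text \<open>A relation rather than a function: on an incomplete domain an operator may have no
  adjoint that maps the domain to itself.\<close>

definition adjoint_op :: "'d::complex_inner operator \<Rightarrow> 'd operator \<Rightarrow> bool" where
  "adjoint_op A B \<longleftrightarrow> (\<forall>x y. cinner (apply_op A x) y = cinner x (apply_op B y))"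

lemma hermitian_iff_adjoint_op: "hermitian A \<longleftrightarrow> adjoint_op A A"
  by (simp add: hermitian_def adjoint_op_def)

lemma adjoint_opD: "adjoint_op A B \<Longrightarrow> cinner (apply_op A x) y = cinner x (apply_op B y)"
  by (simp add: adjoint_op_def)

lemma adjoint_op_sym: "adjoint_op A B \<Longrightarrow> adjoint_op B A"
  unfolding adjoint_op_def by (metis cinner_commute)

lemma adjoint_op_one: "adjoint_op 1 1"
  by (simp add: adjoint_op_def)

lemma adjoint_op_add: "adjoint_op A A' \<Longrightarrow> adjoint_op B B' \<Longrightarrow> adjoint_op (A + B) (A' + B')"
  by (simp add: adjoint_op_def cinner_add_left cinner_add_right)

lemma adjoint_op_scaleC: "adjoint_op A A' \<Longrightarrow> adjoint_op (c *\<^sub>C A) (cnj c *\<^sub>C A')"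
  by (simp add: adjoint_op_def cinner_scaleC_left cinner_scaleC_right)

lemma adjoint_op_mult: "adjoint_op A A' \<Longrightarrow> adjoint_op B B' \<Longrightarrow> adjoint_op (A * B) (B' * A')"
  by (simp add: adjoint_op_def)

lemma adjoint_op_power: "adjoint_op A A' \<Longrightarrow> adjoint_op (A ^ n) (A' ^ n)"
proof (induction n)
  case (Suc n)
  then show ?case
    using adjoint_op_mult[of A A' "A ^ n" "A' ^ n"] by (simp flip: power_Suc2)
qed (simp add: adjoint_op_one)

definition divpow :: "'a::complex_algebra \<Rightarrow> nat \<Rightarrow> 'a" where
  "divpow A n = complex_of_real (1 / fact n) *\<^sub>C A ^ n"

lemma apply_divpow: "apply_op (divpow A n) x = apply_op (A ^ n) x /\<^sub>R fact n"
  by (simp add: divpow_def scaleR_scaleC inverse_eq_divide)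

lemma adjoint_op_divpow: "adjoint_op A A' \<Longrightarrow> adjoint_op (divpow A n) (divpow A' n)"
  using adjoint_op_scaleC[OF adjoint_op_power, of A A' "complex_of_real (1 / fact n)" n]
  by (simp add: divpow_def)

lemma exp_summable_divpow: "exp_summable A \<longleftrightarrow> (\<forall>x. summable (\<lambda>n. apply_op (divpow A n) x))"
  by (simp add: exp_summable_def apply_divpow)

lemma apply_op_exp:
  assumes "exp_summable A"
  shows "apply_op (op_exp A) x = (\<Sum>n. apply_op (divpow A n) x)"
proof -
  have s: "summable (\<lambda>n. apply_op (divpow A n) x)" for x
    using assms by (simp add: exp_summable_divpow)
  show ?thesis
    unfolding op_exp_def apply_divpow[symmetric]
    by (rule apply_op_Op)
      (simp_all add: apply_op_add apply_op_scaleC suminf_add[OF s s]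
        bounded_linear.suminf[OF bounded_linear_scaleC s])
qed

lemma op_exp_sums:
  assumes "exp_summable A"
  shows "(\<lambda>n. apply_op (divpow A n) x) sums apply_op (op_exp A) x"
  using assms unfolding apply_op_exp[OF assms] by (simp add: exp_summable_divpow summable_sums)

lemma op_exp_sums_weak:
  assumes "exp_summable A"
  shows "(\<lambda>n. cinner z (apply_op (divpow A n) x)) sums cinner z (apply_op (op_exp A) x)"
  by (rule bounded_linear.sums[OF bounded_linear_cinner op_exp_sums[OF assms]])

text \<open>The terms of the convergent series for \<open>2 *\<^sub>C A\<close> are bounded, and
  those for \<open>A\<close> are smaller by the factor \<open>2 ^ n\<close> in the denominator: a
  geometric majorant.\<close>

lemma norm_summable_divpow:
  assumes "exp_summable (2 *\<^sub>C A)"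
  shows "summable (\<lambda>n. norm (apply_op (divpow A n) x))"
proof -
  have pow: "apply_op ((2 *\<^sub>C A) ^ n) x = 2 ^ n *\<^sub>C apply_op (A ^ n) x" for n
    by (induction n) (simp_all add: scaleC_one apply_op_scaleC scaleC_scaleC mult.commute)
  have eq: "apply_op (divpow (2 *\<^sub>C A) n) x = 2 ^ n *\<^sub>R apply_op (divpow A n) x" for n
    by (simp only: apply_divpow pow scaleR_scaleC scaleC_scaleC) (simp add: mult.commute)
  have "(\<lambda>n. apply_op (divpow (2 *\<^sub>C A) n) x) \<longlonglongrightarrow> 0"
    using assms by (intro summable_LIMSEQ_zero) (simp add: exp_summable_divpow)
  then have "Bseq (\<lambda>n. apply_op (divpow (2 *\<^sub>C A) n) x)"
    by (intro convergent_imp_Bseq convergentI)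
  then obtain K where K: "\<And>n. norm (apply_op (divpow (2 *\<^sub>C A) n) x) \<le> K"
    by (elim BseqE) blast
  have "norm (norm (apply_op (divpow A n) x)) \<le> K * (1 / 2) ^ n" for n
    using K[of n] by (simp add: eq field_simps)
  then show ?thesis
    by (rule summable_comparison_test'[where N = 0, rotated])
      (intro summable_mult summable_geometric, simp)
qed

lemma adjoint_op_exp:
  assumes "adjoint_op A A'" "exp_summable A" "exp_summable A'"
  shows "adjoint_op (op_exp A) (op_exp A')"
  unfolding adjoint_op_def
proof (intro allI)
  fix x y
  have "(\<lambda>n. cinner y (apply_op (divpow A n) x)) sums cinner y (apply_op (op_exp A) x)"
    by (rule op_exp_sums_weak[OF assms(2)])
  then have "(\<lambda>n. cnj (cinner y (apply_op (divpow A n) x))) sums cnj (cinner y (apply_op (op_exp A) x))"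
    by (rule bounded_linear.sums[OF bounded_linear_cnj])
  then have "(\<lambda>n. cinner (apply_op (divpow A n) x) y) sums cinner (apply_op (op_exp A) x) y"
    by (simp add: cinner_commute[symmetric])
  moreover have "(\<lambda>n. cinner (apply_op (divpow A n) x) y) sums cinner x (apply_op (op_exp A') y)"
    using op_exp_sums_weak[OF assms(3), of x y]
    by (simp add: adjoint_opD[OF adjoint_op_divpow[OF assms(1)]])
  ultimately show "cinner (apply_op (op_exp A) x) y = cinner x (apply_op (op_exp A') y)"
    by (rule sums_unique2)
qed

text \<open>\<open>G\<close> may be discontinuous, so it cannot be applied to the series termwise.
  Its adjoint acts on the test vector instead, where only a fixed vector is changed.\<close>

lemma op_exp_commute:
  assumes "exp_summable A" "adjoint_op G G'" "G * A = A * G"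
  shows "G * op_exp A = op_exp A * G"
proof (rule operator_eqI, rule cinner_eqI)
  fix x z
  have "G * A ^ n = A ^ n * G" for n
    using assms(3) by (simp add: power_commuting_commutes)
  then have pow: "apply_op G (apply_op (divpow A n) x) = apply_op (divpow A n) (apply_op G x)" for n
    unfolding divpow_def by (metis apply_op_simps(6,7) apply_op_scaleC)
  have "(\<lambda>n. cinner (apply_op G' z) (apply_op (divpow A n) x)) sums
      cinner (apply_op G' z) (apply_op (op_exp A) x)"
    by (rule op_exp_sums_weak[OF assms(1)])
  then have "(\<lambda>n. cinner z (apply_op (divpow A n) (apply_op G x))) sums
      cinner z (apply_op G (apply_op (op_exp A) x))"
    by (simp add: adjoint_opD[OF adjoint_op_sym[OF assms(2)]] pow)
  moreover have "(\<lambda>n. cinner z (apply_op (divpow A n) (apply_op G x))) sums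
      cinner z (apply_op (op_exp A) (apply_op G x))"
    by (rule op_exp_sums_weak[OF assms(1)])
  ultimately show "cinner z (apply_op (G * op_exp A) x) = cinner z (apply_op (op_exp A * G) x)"
    using sums_unique2 by auto
qed

section \<open>Exponentials of operators with scalar commutator\<close>

text \<open>Multiples give absolute convergence of the exponential series; the adjoint has to share
  this property because the powers of the left factor are moved to the test vector.\<close>

definition entire_op :: "'d::complex_inner operator \<Rightarrow> bool" where
  "entire_op A \<longleftrightarrow> (\<exists>A'. adjoint_op A A' \<and> (\<forall>c. exp_summable (c *\<^sub>C A)) \<and> (\<forall>c. exp_summable (c *\<^sub>C A')))"

lemma entire_op_exp_summable: "entire_op A \<Longrightarrow> exp_summable A"
  unfolding entire_op_def by (metis cscale_one)

text \<open>With the powers of \<open>A\<close> moved to \<open>z\<close>, the terms are inner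
  products of two norm-summable families. Unconditional summability is what later permits any
  regrouping.\<close>

lemma op_exp_mult_has_sum:
  assumes "entire_op A" "entire_op B"
  shows "((\<lambda>(i, k). cinner z (apply_op (divpow A i * divpow B k) x)) has_sum
    cinner z (apply_op (op_exp A * op_exp B) x)) UNIV"
proof -
  obtain A' where adj: "adjoint_op A A'" and s: "exp_summable (2 *\<^sub>C A')"
    using assms(1) by (auto simp: entire_op_def)
  define f g where "f = (\<lambda>i. apply_op (divpow A' i) z)" and "g = (\<lambda>k. apply_op (divpow B k) x)"
  have sf: "summable (\<lambda>i. norm (f i))"
    unfolding f_def by (rule norm_summable_divpow[OF s])
  have sg: "summable (\<lambda>k. norm (g k))"
    unfolding g_def by (rule norm_summable_divpow) (use assms(2) in \<open>auto simp: entire_op_def\<close>)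
  have swap: "cinner z (apply_op (divpow A i) y) = cinner (f i) y" for i y
    using adjoint_opD[OF adjoint_op_sym[OF adjoint_op_divpow[OF adj]]] by (simp add: f_def)
  have right: "((\<lambda>k. cinner y (g k)) has_sum cinner y (apply_op (op_exp B) x)) UNIV" for y
  proof (rule norm_summable_imp_has_sum)
    show "summable (\<lambda>k. norm (cinner y (g k)))"
      by (rule summable_comparison_test'[where N = 0 and g = "\<lambda>k. 2 * norm y * norm (g k)"])
        (use sg in \<open>auto intro: summable_mult simp: cinner_norm_le\<close>)
    show "(\<lambda>k. cinner y (g k)) sums cinner y (apply_op (op_exp B) x)"
      unfolding g_def by (rule op_exp_sums_weak[OF entire_op_exp_summable[OF assms(2)]])
  qed
  have left: "((\<lambda>i. cinner (f i) y) has_sum cinner z (apply_op (op_exp A) y)) UNIV" for y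
  proof (rule norm_summable_imp_has_sum)
    show "summable (\<lambda>i. norm (cinner (f i) y))"
      by (rule summable_comparison_test'[where N = 0 and g = "\<lambda>k. (2 * norm (f k)) * norm y"])
        (use sf in \<open>auto intro!: summable_mult summable_mult2 simp: cinner_norm_le\<close>)
    show "(\<lambda>i. cinner (f i) y) sums cinner z (apply_op (op_exp A) y)"
      using op_exp_sums_weak[OF entire_op_exp_summable[OF assms(1)], of z y] by (simp add: swap)
  qed
  have abs: "(\<lambda>(i, k). norm (f i) * norm (g k)) summable_on UNIV \<times> UNIV"
  proof -
    have "(\<lambda>i. norm (f i)) summable_on UNIV" "(\<lambda>k. norm (g k)) summable_on UNIV"
      using sf sg by (simp_all add: summable_on_UNIV_nonneg_real_iff)
    then show ?thesis
      by (intro summable_on_SigmaI[where g = "\<lambda>i. norm (f i) * (\<Sum>\<^sub>\<infinity>k. norm (g k))"])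
        (auto intro: has_sum_cmult_right summable_on_cmult_left)
  qed
  have "(\<lambda>(i, k). cinner (f i) (g k)) summable_on UNIV \<times> UNIV"
  proof (rule abs_summable_summable, rule Infinite_Sum.abs_summable_on_comparison_test')
    show "(\<lambda>p. 2 * (case p of (i, k) \<Rightarrow> norm (f i) * norm (g k))) summable_on UNIV \<times> UNIV"
      by (rule summable_on_cmult_right[OF abs])
  next
    fix p :: "nat \<times> nat"
    show "norm (case p of (i, k) \<Rightarrow> cinner (f i) (g k)) \<le> 2 * (case p of (i, k) \<Rightarrow> norm (f i) * norm (g k))"
      using cinner_norm_le[of "f (fst p)" "g (snd p)"] by (simp add: case_prod_unfold mult.assoc)
  qed
  then have "((\<lambda>(i, k). cinner (f i) (g k)) has_sum
      cinner z (apply_op (op_exp A) (apply_op (op_exp B) x))) (UNIV \<times> UNIV)"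
    by (intro has_sum_SigmaI[OF _ left]) (simp_all add: right)
  then show ?thesis
    by (simp add: swap[symmetric] g_def)
qed

lemma has_sum_fibres_sums:
  fixes f :: "'i \<Rightarrow> complex" and \<phi> :: "'i \<Rightarrow> nat"
  assumes "(f has_sum S) UNIV" and fin: "\<And>N. finite {p. \<phi> p = N}"
  shows "(\<lambda>N. \<Sum>p | \<phi> p = N. f p) sums S"
proof -
  have img: "range (\<lambda>p. (\<phi> p, p)) = Sigma UNIV (\<lambda>N. {p. \<phi> p = N})"
    by auto
  have "((\<lambda>q. f (snd q)) has_sum S) (range (\<lambda>p. (\<phi> p, p)))"
    by (subst has_sum_reindex) (use assms(1) in \<open>auto simp: inj_on_def o_def\<close>)
  then have "((\<lambda>N. \<Sum>p | \<phi> p = N. f p) has_sum S) UNIV"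
    unfolding img by (rule has_sum_SigmaD) (simp add: fin has_sum_finite)
  then show ?thesis
    by (rule has_sum_imp_sums)
qed

lemma cinner_apply_op_sum:
  "cinner z (apply_op (sum F I) x) = (\<Sum>i\<in>I. cinner z (apply_op (F i) x))"
  by (induction I rule: infinite_finite_induct) (simp_all add: cinner_add_right)

text \<open>Divided powers with integer index, so that index shifts need no side conditions.\<close>
definition idivpow :: "'a::complex_algebra \<Rightarrow> int \<Rightarrow> 'a" where
  "idivpow A n = (if n < 0 then 0 else divpow A (nat n))"

lemma divpow_0 [simp]: "divpow A 0 = 1"
  by (simp add: divpow_def cscale_one)

lemma mult_divpow: "A * divpow A n = of_nat (Suc n) *\<^sub>C divpow A (Suc n)"
  by (simp add: divpow_def cscale_mult_right cscale_cscale del: of_nat_Suc)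

lemma mult_idivpow: "A * idivpow A (n - 1) = of_int n *\<^sub>C idivpow A n"
proof (cases "n \<ge> 1")
  case True
  then have "nat n = Suc (nat (n - 1))" by simp
  then show ?thesis
    using True mult_divpow[of A "nat (n - 1)"] by (simp add: idivpow_def)
qed (auto simp: idivpow_def not_le)

text \<open>Commutation with \<open>B\<close> is a derivation sending \<open>A\<close> to the scalar
  \<open>c\<close>, so it acts on divided powers like \<open>c\<close> times d/dA. The induction
  step is proved after multiplication by the nonzero number \<open>n + 1\<close>.\<close>

lemma divpow_commutator:
  fixes A B :: "'a::complex_algebra"
  assumes "A * B - B * A = c *\<^sub>C 1"
  shows "idivpow A n * B = B * idivpow A n + c *\<^sub>C idivpow A (n - 1)"
proof (cases "n \<ge> 0")
  case True
  then show ?thesis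
  proof (induction n rule: int_ge_induct)
    case base
    show ?case by (simp add: idivpow_def)
  next
    case (step n)
    let ?m = "of_int (n + 1) :: complex"
    have AB: "A * B = B * A + c *\<^sub>C 1"
      using assms by (simp add: algebra_simps)
    have m: "A * idivpow A n = ?m *\<^sub>C idivpow A (n + 1)"
      using mult_idivpow[of A "n + 1"] by simp
    have "?m *\<^sub>C (idivpow A (n + 1) * B) = A * (idivpow A n * B)"
      by (simp add: m mult.assoc[symmetric] cscale_mult_left[symmetric])
    also have "\<dots> = (A * B) * idivpow A n + c *\<^sub>C (A * idivpow A (n - 1))"
      using step by (simp add: algebra_simps cscale_mult_right)
    also have "\<dots> = B * (?m *\<^sub>C idivpow A (n + 1)) + c *\<^sub>C (idivpow A n + of_int n *\<^sub>C idivpow A n)"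
      unfolding AB mult_idivpow m[symmetric] by (simp add: algebra_simps cscale_mult_left cscale_add)
    also have "\<dots> = ?m *\<^sub>C (B * idivpow A (n + 1) + c *\<^sub>C idivpow A n)"
      by (simp add: cscale_add add_cscale cscale_mult_right cscale_cscale algebra_simps cscale_one)
    finally have "?m *\<^sub>C (idivpow A (n + 1) * B) = ?m *\<^sub>C (B * idivpow A (n + 1) + c *\<^sub>C idivpow A n)" .
    moreover have "?m \<noteq> 0"
      using step.hyps by (simp del: of_int_add)
    ultimately show ?case
      using cvs.scale_left_imp_eq by auto
  qed
qed (simp add: idivpow_def)

lemma sum_support_eq:
  fixes f :: "int \<Rightarrow> 'a::comm_monoid_add"
  assumes "\<And>i. i \<notin> {0..N} \<Longrightarrow> f i = 0" "finite S" "{0..N} \<subseteq> S"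
  shows "sum f S = sum f {0..N}"
  using assms by (intro sum.mono_neutral_right) auto

lemma sum_support_shift:
  fixes f :: "int \<Rightarrow> 'a::comm_monoid_add"
  assumes "\<And>i. i \<notin> {0..N'} \<Longrightarrow> f i = 0" "N' < N"
  shows "(\<Sum>i\<in>{0..N}. f (i - 1)) = sum f {0..N'}"
proof -
  have "(\<Sum>i\<in>{0..N}. f (i - 1)) = sum f {-1..N-1}"
    by (rule sum.reindex_bij_witness[where i = "\<lambda>i. i + 1" and j = "\<lambda>i. i - 1"]) auto
  also have "\<dots> = sum f {0..N'}"
    by (rule sum_support_eq) (use assms in auto)
  finally show ?thesis .
qed

lemma cscale_sum: "c *\<^sub>C sum f S = (\<Sum>i\<in>S. c *\<^sub>C (f i :: 'a::complex_algebra))"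
  by (rule cvs.scale_sum_right)

text \<open>Both sides are the coefficients of \<open>exp (s A) exp (s B)\<close> in \<open>s\<close>, and they satisfy the
  recursion expressing \<open>F' = (A + B + s c) F\<close>.\<close>
lemma divpow_commutator_sum:
  fixes A B :: "'a::complex_algebra"
  assumes AB: "A * B - B * A = c *\<^sub>C 1"
  shows "(\<Sum>i\<in>{0..int N}. idivpow A i * idivpow B (int N - i))
    = (\<Sum>j\<in>{0..int N}. idivpow ((c / 2) *\<^sub>C 1) j * idivpow (A + B) (int N - 2 * j))"
proof -
  define C D where "C = (c / 2) *\<^sub>C (1::'a)" and "D = A + B"
  define P where "P = (\<lambda>n. \<Sum>i\<in>{0..n}. idivpow A i * idivpow B (n - i))"
  define Q where "Q = (\<lambda>n. \<Sum>j\<in>{0..n}. idivpow C j * idivpow D (n - 2 * j))"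
  have P: "(\<Sum>i\<in>S. idivpow A i * idivpow B (n - i)) = P n" if "finite S" "{0..n} \<subseteq> S" for S n
    unfolding P_def by (rule sum_support_eq) (use that in \<open>auto simp: idivpow_def\<close>)
  have P': "(\<Sum>i\<in>{0..N}. idivpow A (i - 1) * idivpow B (n - (i - 1))) = P n" if "n < N" for n N
    unfolding P_def by (rule sum_support_shift) (use that in \<open>auto simp: idivpow_def\<close>)
  have Q: "(\<Sum>i\<in>S. idivpow C i * idivpow D (n - 2 * i)) = Q n" if "finite S" "{0..n} \<subseteq> S" for S n
    unfolding Q_def by (rule sum_support_eq) (use that in \<open>auto simp: idivpow_def\<close>)
  have Q': "(\<Sum>i\<in>{0..N}. idivpow C (i - 1) * idivpow D (n - 2 * (i - 1))) = Q n" if "n < N" for n N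
    unfolding Q_def by (rule sum_support_shift) (use that in \<open>auto simp: idivpow_def\<close>)
  have recP: "of_int n *\<^sub>C P n = D * P (n - 1) + c *\<^sub>C P (n - 2)" if "n \<ge> 0" for n
  proof -
    have "of_int n *\<^sub>C (idivpow A i * idivpow B (n - i)) =
        A * (idivpow A (i - 1) * idivpow B (n - 1 - (i - 1))) + B * (idivpow A i * idivpow B (n - 1 - i))
        + c *\<^sub>C (idivpow A (i - 1) * idivpow B (n - 2 - (i - 1)))" for i
    proof -
      \<comment> \<open>Leibniz rule on coefficients: split \<open>n\<close> as
        \<open>i + (n - i)\<close> and lower the index of one factor. Moving \<open>B\<close> to the
        front costs the commutator term.\<close>
      have "of_int n *\<^sub>C (idivpow A i * idivpow B (n - i)) =
        (of_int i *\<^sub>C idivpow A i) * idivpow B (n - i) + idivpow A i * (of_int (n - i) *\<^sub>C idivpow B (n - i))"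
        by (simp add: cscale_mult_left cscale_mult_right flip: add_cscale)
      also have "\<dots> = A * (idivpow A (i - 1) * idivpow B (n - i)) + (idivpow A i * B) * idivpow B (n - i - 1)"
        by (simp only: mult_idivpow[symmetric] mult.assoc)
      also have "idivpow A i * B = B * idivpow A i + c *\<^sub>C idivpow A (i - 1)"
        by (rule divpow_commutator[OF AB])
      finally show ?thesis
        by (simp add: algebra_simps cscale_mult_left)
    qed
    then have "of_int n *\<^sub>C P n =
       (\<Sum>i\<in>{0..n}. A * (idivpow A (i - 1) * idivpow B (n - 1 - (i - 1))))
       + (\<Sum>i\<in>{0..n}. B * (idivpow A i * idivpow B (n - 1 - i)))
       + (\<Sum>i\<in>{0..n}. c *\<^sub>C (idivpow A (i - 1) * idivpow B (n - 2 - (i - 1))))"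
      by (simp only: P_def cscale_sum sum.distrib)
    also have "\<dots> = A * P (n - 1) + B * P (n - 1) + c *\<^sub>C P (n - 2)"
      unfolding sum_distrib_left[symmetric] cscale_sum[symmetric] using that
      by (simp only: P P' finite_atLeastAtMost_int) (subst P; simp)
    finally show ?thesis
      by (simp add: D_def algebra_simps)
  qed
  have recQ: "of_int n *\<^sub>C Q n = D * Q (n - 1) + c *\<^sub>C Q (n - 2)" if "n \<ge> 0" for n
  proof -
    have C: "C * x = (c / 2) *\<^sub>C x" "x * C = (c / 2) *\<^sub>C x" for x
      by (simp_all add: C_def cscale_mult_left cscale_mult_right)
    have CD: "C * D - D * C = 0 *\<^sub>C 1"
      by (simp add: C)
    have "of_int n *\<^sub>C (idivpow C i * idivpow D (n - 2 * i)) =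
        D * (idivpow C i * idivpow D (n - 1 - 2 * i))
        + c *\<^sub>C (idivpow C (i - 1) * idivpow D (n - 2 - 2 * (i - 1)))" for i
    proof -
      \<comment> \<open>Now \<open>n\<close> is \<open>2 * i + (n - 2 * i)\<close>: the scalar
        exponent \<open>C\<close> stands at the square of the formal variable and therefore has
        degree two.\<close>
      have "of_int n *\<^sub>C (idivpow C i * idivpow D (n - 2 * i)) =
        2 *\<^sub>C (of_int i *\<^sub>C idivpow C i) * idivpow D (n - 2 * i)
          + idivpow C i * (of_int (n - 2 * i) *\<^sub>C idivpow D (n - 2 * i))"
        by (simp add: cscale_mult_left cscale_mult_right cscale_cscale flip: add_cscale)
      also have "\<dots> = c *\<^sub>C (idivpow C (i - 1) * idivpow D (n - 2 * i)) + (idivpow C i * D) * idivpow D (n - 2 * i - 1)"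
        by (simp only: mult_idivpow[symmetric] mult.assoc C cscale_cscale cscale_mult_left) simp
      also have "idivpow C i * D = D * idivpow C i"
        using divpow_commutator[OF CD] by simp
      finally show ?thesis
        by (simp add: algebra_simps)
    qed
    then have "of_int n *\<^sub>C Q n =
       (\<Sum>i\<in>{0..n}. D * (idivpow C i * idivpow D (n - 1 - 2 * i)))
       + (\<Sum>i\<in>{0..n}. c *\<^sub>C (idivpow C (i - 1) * idivpow D (n - 2 - 2 * (i - 1))))"
      by (simp only: Q_def cscale_sum sum.distrib)
    also have "\<dots> = D * Q (n - 1) + c *\<^sub>C Q (n - 2)"
      unfolding sum_distrib_left[symmetric] cscale_sum[symmetric] using that
      by (subst Q; (subst Q')?; simp)
    finally show ?thesis .
  qed
  \<comment> \<open>Negative \<open>n\<close> are included because the two-step recursion reaches -1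
    from 1; there both sums are empty.\<close>
  have "P n = Q n" if "n \<le> int N" for n
    using that
  proof (induction "nat n" arbitrary: n rule: less_induct)
    case less
    consider "n < 0" | "n = 0" | "n > 0" by linarith
    then show ?case
    proof cases
      case 3
      then have "P (n - 1) = Q (n - 1)"
        using less.prems by (intro less.hyps) auto
      moreover have "P (n - 2) = Q (n - 2)"
        using less.prems 3 by (intro less.hyps) auto
      ultimately have "of_int n *\<^sub>C P n = of_int n *\<^sub>C Q n"
        using 3 by (simp add: recP recQ)
      then show ?thesis
        using 3 by (simp add: cvs.scale_left_imp_eq)
    qed (simp_all add: P_def Q_def idivpow_def)
  qed
  then show ?thesis
    by (simp add: P_def Q_def C_def D_def)
qed

lemma sum_fibre_add:
  "(\<Sum>(i, k) | i + k = N. divpow A i * divpow B k) = (\<Sum>i\<in>{0..int N}. idivpow A i * idivpow B (int N - i))"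
  by (rule sum.reindex_bij_witness[where i = "\<lambda>i. (nat i, nat (int N - i))" and j = "\<lambda>(i, k). int i"])
    (auto simp: idivpow_def)

lemma sum_fibre_double_add:
  "(\<Sum>(j, m) | 2 * j + m = N. divpow C j * divpow D m)
    = (\<Sum>j\<in>{0..int N}. idivpow C j * idivpow D (int N - 2 * j))"
proof -
  have "(\<Sum>(j, m) | 2 * j + m = N. divpow C j * divpow D m)
      = (\<Sum>j\<in>{0..int N div 2}. idivpow C j * idivpow D (int N - 2 * j))"
    by (rule sum.reindex_bij_witness[where i = "\<lambda>j. (nat j, nat (int N - 2 * j))" and j = "\<lambda>(j, m). int j"])
      (auto simp: idivpow_def)
  also have "\<dots> = (\<Sum>j\<in>{0..int N}. idivpow C j * idivpow D (int N - 2 * j))"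
    by (rule sum.mono_neutral_left) (auto simp: idivpow_def)
  finally show ?thesis .
qed

lemma entire_op_scalar: "entire_op (c *\<^sub>C (1 :: 'd::complex_inner operator))"
  and op_exp_scalar: "op_exp (c *\<^sub>C (1 :: 'd operator)) = exp c *\<^sub>C 1"
proof -
  have pow: "divpow (c *\<^sub>C (1 :: 'd operator)) n = (c ^ n / fact n) *\<^sub>C 1" for c n
  proof -
    have "(c *\<^sub>C (1 :: 'd operator)) ^ n = c ^ n *\<^sub>C 1"
      by (induction n) (simp_all add: cscale_one cscale_mult_left cscale_cscale)
    then show ?thesis
      by (simp add: divpow_def cscale_cscale)
  qed
  have "(\<lambda>n. (c ^ n / fact n) *\<^sub>C x) sums (exp c *\<^sub>C x)" for c and x :: 'd
  proof -
    have bl: "bounded_linear (\<lambda>c. c *\<^sub>C x)"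
      by (rule bounded_linear_intro[where K = "norm x"])
        (simp_all add: scaleC_add_left scaleR_scaleC scaleC_scaleC scaleR_conv_of_real norm_scaleC)
    have "(\<lambda>n. c ^ n /\<^sub>R fact n) sums exp c"
      by (rule exp_converges)
    from bounded_linear.sums[OF bl this] show ?thesis
      by (simp add: scaleR_conv_of_real field_simps)
  qed
  then have sums: "(\<lambda>n. apply_op (divpow (c *\<^sub>C (1 :: 'd operator)) n) x) sums (exp c *\<^sub>C x)" for c x
    by (simp add: pow)
  then have *: "exp_summable (c *\<^sub>C (1 :: 'd operator))" for c
    by (auto simp: exp_summable_divpow summable_def)
  then show "entire_op (c *\<^sub>C (1 :: 'd operator))"
    unfolding entire_op_def by (intro exI[of _ "cnj c *\<^sub>C 1"])
      (simp add: cscale_cscale adjoint_op_scaleC adjoint_op_one)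
  show "op_exp (c *\<^sub>C (1 :: 'd operator)) = exp c *\<^sub>C 1"
    by (rule operator_eqI) (use sums_unique2[OF op_exp_sums[OF *] sums] in simp)
qed

text \<open>The factor \<open>exp (c / 2)\<close> is itself the exponential of a scalar operator, so
  both sides are products of two exponentials. Their double series are regrouped by
  \<open>i + k\<close> and by \<open>2 * i + k\<close>, with equal finite sums in each
  degree.\<close>

lemma op_exp_commutator:
  fixes A B :: "'d::complex_inner operator"
  assumes "entire_op A" "entire_op B" "entire_op (A + B)" and AB: "A * B - B * A = c *\<^sub>C 1"
  shows "op_exp A * op_exp B = exp (c / 2) *\<^sub>C op_exp (A + B)"
proof (rule operator_eqI, rule cinner_eqI)
  fix z x :: 'd
  let ?C = "(c / 2) *\<^sub>C (1 :: 'd operator)"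
  have fin1: "finite {p :: nat \<times> nat. (case p of (i, k) \<Rightarrow> i + k) = N}" for N
    by (rule finite_subset[of _ "{..N} \<times> {..N}"]) auto
  have fin2: "finite {p :: nat \<times> nat. (case p of (i, k) \<Rightarrow> 2 * i + k) = N}" for N
    by (rule finite_subset[of _ "{..N} \<times> {..N}"]) auto
  have s1: "(\<lambda>N. cinner z (apply_op (\<Sum>(i, k) | i + k = N. divpow A i * divpow B k) x)) sums
      cinner z (apply_op (op_exp A * op_exp B) x)"
    using has_sum_fibres_sums[OF op_exp_mult_has_sum[OF assms(1,2)] fin1]
    by (simp add: cinner_apply_op_sum case_prod_unfold)
  have s2: "(\<lambda>N. cinner z (apply_op (\<Sum>(i, k) | 2 * i + k = N. divpow ?C i * divpow (A + B) k) x)) sums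
      cinner z (apply_op (op_exp ?C * op_exp (A + B)) x)"
    using has_sum_fibres_sums[OF op_exp_mult_has_sum[OF entire_op_scalar assms(3)] fin2]
    by (simp add: cinner_apply_op_sum case_prod_unfold)
  have "cinner z (apply_op (op_exp A * op_exp B) x) = cinner z (apply_op (op_exp ?C * op_exp (A + B)) x)"
    using s1 s2 unfolding sum_fibre_add sum_fibre_double_add divpow_commutator_sum[OF AB]
    by (rule sums_unique2)
  then show "cinner z (apply_op (op_exp A * op_exp B) x) = cinner z (apply_op (exp (c / 2) *\<^sub>C op_exp (A + B)) x)"
    by (simp add: op_exp_scalar)
qed

lemma op_exp_add_scalar:
  fixes B :: "'d::complex_inner operator"
  assumes "entire_op B" "entire_op (B + c *\<^sub>C 1)"
  shows "op_exp (B + c *\<^sub>C 1) = exp c *\<^sub>C op_exp B"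
  using op_exp_commutator[OF assms(1) entire_op_scalar assms(2), of 0]
  by (simp add: op_exp_scalar cscale_mult_left cscale_mult_right cscale_one)

section \<open>Quantum shear coordinates\<close>

text \<open>The constant coefficient absorbs both the commutator in the product formula and
  translations of the coordinates.\<close>

definition shear_lin :: "'d::complex_inner shear_data \<Rightarrow> complex \<Rightarrow> complex \<Rightarrow> complex \<Rightarrow> complex \<Rightarrow> 'd operator" where
  "shear_lin d a0 a1 a2 a3 = a0 *\<^sub>C 1 + a1 *\<^sub>C Y1 d + a2 *\<^sub>C Y2 d + a3 *\<^sub>C Y3 d"

definition shear_exp :: "'d::complex_inner shear_data \<Rightarrow> real \<Rightarrow> real \<Rightarrow> real \<Rightarrow> 'd operator" where
  "shear_exp d a b c = op_exp (shear_lin d 0 (of_real a) (of_real b) (of_real c))"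

lemma shear_lin_add:
  "shear_lin d a0 a1 a2 a3 + shear_lin d b0 b1 b2 b3 = shear_lin d (a0 + b0) (a1 + b1) (a2 + b2) (a3 + b3)"
  by (simp add: shear_lin_def add_cscale algebra_simps)

lemma shear_lin_scaleC: "c *\<^sub>C shear_lin d a0 a1 a2 a3 = shear_lin d (c * a0) (c * a1) (c * a2) (c * a3)"
  by (simp add: shear_lin_def cscale_add cscale_cscale)

lemma q_pow_add: "q_pow h s * q_pow h t = q_pow h (s + t)"
  by (simp add: q_pow_def algebra_simps flip: exp_add)

lemma q_pow_0 [simp]: "q_pow h 0 = 1"
  by (simp add: q_pow_def)

context
  fixes h :: real and d :: "'d::complex_inner shear_data"
  assumes d: "d \<in> quantum_shear h"
begin

lemma adjoint_shear_lin:
  "adjoint_op (shear_lin d a0 a1 a2 a3) (shear_lin d (cnj a0) (cnj a1) (cnj a2) (cnj a3))"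
  using d unfolding shear_lin_def quantum_shear_def
  by (auto intro!: adjoint_op_add adjoint_op_scaleC adjoint_op_one simp: hermitian_iff_adjoint_op)

lemma entire_shear_lin: "entire_op (shear_lin d a0 a1 a2 a3)"
proof -
  have "exp_summable (shear_lin d b0 b1 b2 b3)" for b0 b1 b2 b3
    using d unfolding quantum_shear_def shear_lin_def by simp
  then show ?thesis
    unfolding entire_op_def
    by (intro exI[of _ "shear_lin d (cnj a0) (cnj a1) (cnj a2) (cnj a3)"])
      (simp add: adjoint_shear_lin shear_lin_scaleC)
qed

lemma shear_lin_commutator:
  "shear_lin d a0 a1 a2 a3 * shear_lin d b0 b1 b2 b3 - shear_lin d b0 b1 b2 b3 * shear_lin d a0 a1 a2 a3
    = (\<i> * pi * h * (a1 * b2 - a2 * b1 + (a2 * b3 - a3 * b2) + (a3 * b1 - a1 * b3))) *\<^sub>C 1"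
proof -
  let ?k = "(\<i> * pi * h) *\<^sub>C (1 :: 'd operator)"
  have *: "Y1 d * Y2 d = Y2 d * Y1 d + ?k" "Y2 d * Y3 d = Y3 d * Y2 d + ?k" "Y3 d * Y1 d = Y1 d * Y3 d + ?k"
    using d unfolding quantum_shear_def by (simp_all add: diff_eq_eq add.commute)
  show ?thesis
    unfolding shear_lin_def
    by (simp add: distrib_left distrib_right cscale_mult_left cscale_mult_right cscale_add cscale_cscale *
        cvs.scale_left_diff_distrib add_cscale algebra_simps)
qed

lemma op_exp_shear_lin:
  "op_exp (shear_lin d a0 a1 a2 a3) * op_exp (shear_lin d b0 b1 b2 b3) =
    op_exp (shear_lin d (a0 + b0 + \<i> * pi * h * (a1 * b2 - a2 * b1 + (a2 * b3 - a3 * b2) + (a3 * b1 - a1 * b3)) / 2)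
      (a1 + b1) (a2 + b2) (a3 + b3))" (is "?l = op_exp (shear_lin d (_ + ?c / 2) _ _ _)")
proof -
  have "?l = exp (?c / 2) *\<^sub>C op_exp (shear_lin d a0 a1 a2 a3 + shear_lin d b0 b1 b2 b3)"
    by (rule op_exp_commutator[OF entire_shear_lin entire_shear_lin _ shear_lin_commutator])
      (simp add: shear_lin_add entire_shear_lin)
  also have "\<dots> = op_exp (shear_lin d a0 a1 a2 a3 + shear_lin d b0 b1 b2 b3 + (?c / 2) *\<^sub>C 1)"
  proof (rule op_exp_add_scalar[symmetric])
    have "shear_lin d (?c / 2) 0 0 0 = (?c / 2) *\<^sub>C 1"
      by (simp add: shear_lin_def)
    then show "entire_op (shear_lin d a0 a1 a2 a3 + shear_lin d b0 b1 b2 b3 + (?c / 2) *\<^sub>C 1)"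
      by (metis shear_lin_add entire_shear_lin)
  qed (simp add: shear_lin_add entire_shear_lin)
  also have "shear_lin d a0 a1 a2 a3 + shear_lin d b0 b1 b2 b3 + (?c / 2) *\<^sub>C 1 =
      shear_lin d (a0 + b0 + ?c / 2) (a1 + b1) (a2 + b2) (a3 + b3)"
    by (simp add: shear_lin_def add_cscale algebra_simps)
  finally show ?thesis .
qed

lemma op_exp_shear_lin_const:
  "op_exp (shear_lin d a0 a1 a2 a3) = exp a0 *\<^sub>C op_exp (shear_lin d 0 a1 a2 a3)"
proof -
  have eq: "shear_lin d a0 a1 a2 a3 = shear_lin d 0 a1 a2 a3 + a0 *\<^sub>C 1"
    by (simp add: shear_lin_def)
  show ?thesis
    unfolding eq by (rule op_exp_add_scalar) (simp_all add: entire_shear_lin flip: eq)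
qed

text \<open>The quantum torus of a cyclic skew form. Its radical contains \<open>(1, 1, 1)\<close>,
  which is the reason for the centrality of \<open>Ginf\<close>.\<close>

lemma shear_exp_mult:
  "shear_exp d a b c * shear_exp d a' b' c' =
    q_pow h ((a * b' - b * a' + (b * c' - c * b') + (c * a' - a * c')) / 2)
      *\<^sub>C shear_exp d (a + a') (b + b') (c + c')"
  unfolding shear_exp_def op_exp_shear_lin
  by (subst op_exp_shear_lin_const) (simp add: q_pow_def algebra_simps)

lemma shear_exp_0: "shear_exp d 0 0 0 = 1"
  using op_exp_scalar[of 0, where 'd = 'd] by (simp add: shear_exp_def shear_lin_def cscale_one)

lemma hermitian_shear_exp: "hermitian (shear_exp d a b c)"
  unfolding hermitian_iff_adjoint_op shear_exp_def
  using adjoint_op_exp[OF adjoint_shear_lin, of 0 "of_real a" "of_real b" "of_real c"]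
  by (simp add: entire_op_exp_summable[OF entire_shear_lin])

lemma central_commute:
  assumes "G \<in> {G1 d, G2 d, G3 d}"
  shows "hermitian G" "G * Y1 d = Y1 d * G" "G * Y2 d = Y2 d * G" "G * Y3 d = Y3 d * G"
    "G * G1 d = G1 d * G" "G * G2 d = G2 d * G" "G * G3 d = G3 d * G"
  using d assms unfolding quantum_shear_def by blast+

lemma central_shear_exp:
  assumes "G \<in> {G1 d, G2 d, G3 d}"
  shows "shear_exp d a b c * G = G * shear_exp d a b c"
proof -
  have "G * shear_lin d 0 (of_real a) (of_real b) (of_real c) = shear_lin d 0 (of_real a) (of_real b) (of_real c) * G"
    by (simp add: shear_lin_def distrib_left distrib_right cscale_mult_left cscale_mult_right
        central_commute(2,3,4)[OF assms])
  from op_exp_commute[OF entire_op_exp_summable[OF entire_shear_lin] _ this] show ?thesis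
    using central_commute(1)[OF assms] unfolding shear_exp_def hermitian_iff_adjoint_op by metis
qed

lemma geodesic_shear_exp:
  "G12 d = shear_exp d 1 1 0 + shear_exp d (-1) (-1) 0 + shear_exp d (-1) 1 0
     + G1 d * shear_exp d 0 1 0 + G2 d * shear_exp d (-1) 0 0"
  "G23 d = shear_exp d 0 1 1 + shear_exp d 0 (-1) (-1) + shear_exp d 0 (-1) 1
     + G2 d * shear_exp d 0 0 1 + G3 d * shear_exp d 0 (-1) 0"
  "G13 d = shear_exp d 1 0 1 + shear_exp d (-1) 0 (-1) + shear_exp d 1 0 (-1)
     + G3 d * shear_exp d 1 0 0 + G1 d * shear_exp d 0 0 (-1)"
  "Ginf d = shear_exp d 1 1 1 + shear_exp d (-1) (-1) (-1)"
  by (simp_all add: G12_def G23_def G13_def Ginf_def shear_exp_def shear_lin_def cscale_one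
      diff_conv_add_uminus add.commute cscale_minus_left del: uminus_add_conv_diff add_uminus_conv_diff)

lemma hermitian_geodesics:
  "hermitian (G12 d)" "hermitian (G23 d)" "hermitian (G13 d)" "hermitian (Ginf d)"
proof -
  note * = hermitian_shear_exp[unfolded hermitian_iff_adjoint_op] central_shear_exp
    central_commute(1)[unfolded hermitian_iff_adjoint_op]
  have "adjoint_op (G * shear_exp d a b c) (G * shear_exp d a b c)" if "G \<in> {G1 d, G2 d, G3 d}" for G a b c
    using adjoint_op_mult[OF *(3)[OF that] *(1)] *(2)[OF that] by simp
  then show "hermitian (G12 d)" "hermitian (G23 d)" "hermitian (G13 d)" "hermitian (Ginf d)"
    unfolding hermitian_iff_adjoint_op geodesic_shear_exp by (auto intro!: adjoint_op_add *(1))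
qed

lemma central_left_commute:
  "shear_exp d a b c * G1 d = G1 d * shear_exp d a b c" "shear_exp d a b c * (G1 d * x) = G1 d * (shear_exp d a b c * x)"
  "shear_exp d a b c * G2 d = G2 d * shear_exp d a b c" "shear_exp d a b c * (G2 d * x) = G2 d * (shear_exp d a b c * x)"
  "shear_exp d a b c * G3 d = G3 d * shear_exp d a b c" "shear_exp d a b c * (G3 d * x) = G3 d * (shear_exp d a b c * x)"
  "G2 d * G1 d = G1 d * G2 d" "G2 d * (G1 d * x) = G1 d * (G2 d * x)"
  "G3 d * G1 d = G1 d * G3 d" "G3 d * (G1 d * x) = G1 d * (G3 d * x)"
  "G3 d * G2 d = G2 d * G3 d" "G3 d * (G2 d * x) = G2 d * (G3 d * x)"
proof -
  have swap: "a * (b * x) = b * (a * x)" if "a * b = b * a" for a b x :: "'d operator"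
    using that by (metis mult.assoc)
  show "shear_exp d a b c * G1 d = G1 d * shear_exp d a b c" "shear_exp d a b c * G2 d = G2 d * shear_exp d a b c"
    "shear_exp d a b c * G3 d = G3 d * shear_exp d a b c"
    by (rule central_shear_exp; simp)+
  then show "shear_exp d a b c * (G1 d * x) = G1 d * (shear_exp d a b c * x)"
    "shear_exp d a b c * (G2 d * x) = G2 d * (shear_exp d a b c * x)"
    "shear_exp d a b c * (G3 d * x) = G3 d * (shear_exp d a b c * x)"
    by - (rule swap, assumption)+
  show "G2 d * G1 d = G1 d * G2 d" "G3 d * G1 d = G1 d * G3 d" "G3 d * G2 d = G2 d * G3 d"
    by (rule central_commute(5) central_commute(6); simp)+
  then show "G2 d * (G1 d * x) = G1 d * (G2 d * x)" "G3 d * (G1 d * x) = G1 d * (G3 d * x)"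
    "G3 d * (G2 d * x) = G2 d * (G3 d * x)"
    by - (rule swap, assumption)+
qed

lemma shear_exp_mult_left:
  "shear_exp d a b c * (shear_exp d a' b' c' * x) =
    q_pow h ((a * b' - b * a' + (b * c' - c * b') + (c * a' - a * c')) / 2)
      *\<^sub>C (shear_exp d (a + a') (b + b') (c + c') * x)"
  by (simp add: mult.assoc[symmetric] shear_exp_mult cscale_mult_left)

text \<open>Normal form: a power of \<open>q\<close>, an ordered word in the \<open>G1\<close>,
  \<open>G2\<close>, \<open>G3\<close>, and a single \<open>shear_exp\<close>. Identities between
  geodesic operators are then decided by expansion.\<close>

lemmas torus_simps =
  distrib_left distrib_right cscale_mult_left cscale_mult_right mult.assoc cscale_add cscale_cscale
  shear_exp_mult shear_exp_mult_left central_left_commute shear_exp_0 q_pow_add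
  cvs.scale_left_diff_distrib cvs.scale_right_diff_distrib add_cscale cscale_one

end

lemma commutation_G12_G23:
  assumes d: "d \<in> quantum_shear h"
  shows "q_pow h (- 1/2) *\<^sub>C (G12 d * G23 d) - q_pow h (1/2) *\<^sub>C (G23 d * G12 d)
    = (q_pow h (- 1) - q_pow h 1) *\<^sub>C G13 d + (q_pow h (- 1/2) - q_pow h (1/2)) *\<^sub>C omega13 d"
  unfolding omega13_def geodesic_shear_exp[OF d]
  by (simp add: torus_simps[OF d])

lemma geodesics_commute_Ginf:
  assumes d: "d \<in> quantum_shear h"
  shows "G12 d * Ginf d = Ginf d * G12 d" "G23 d * Ginf d = Ginf d * G23 d" "G13 d * Ginf d = Ginf d * G13 d"
  unfolding geodesic_shear_exp[OF d] by (simp_all add: torus_simps[OF d])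

lemma central_Ginf:
  assumes d: "d \<in> quantum_shear h"
  shows "G1 d * Ginf d = Ginf d * G1 d" "G2 d * Ginf d = Ginf d * G2 d" "G3 d * Ginf d = Ginf d * G3 d"
  unfolding geodesic_shear_exp[OF d] by (simp_all add: torus_simps[OF d])

lemma central_geodesics:
  assumes d: "d \<in> quantum_shear h" and "G \<in> {G1 d, G2 d, G3 d}"
  shows "G12 d * G = G * G12 d" "G23 d * G = G * G23 d" "G13 d * G = G * G13 d"
  using assms(2) unfolding geodesic_shear_exp[OF d] by (auto simp: torus_simps[OF d])

text \<open>The cyclic symmetry of the brackets. It yields the other two commutation relations from
  the first.\<close>

definition rotate_shear :: "'d::complex_inner shear_data \<Rightarrow> 'd shear_data" where
  "rotate_shear d = \<lparr>Y1 = Y2 d, Y2 = Y3 d, Y3 = Y1 d, G1 = G2 d, G2 = G3 d, G3 = G1 d\<rparr>"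

lemma rotate_shear:
  assumes d: "d \<in> quantum_shear h"
  shows "rotate_shear d \<in> quantum_shear h"
    "G12 (rotate_shear d) = G23 d" "G23 (rotate_shear d) = G13 d" "G13 (rotate_shear d) = G12 d"
    "omega12 (rotate_shear d) = omega23 d" "omega23 (rotate_shear d) = omega13 d" "omega13 (rotate_shear d) = omega12 d"
proof -
  have eq: "a0 *\<^sub>C 1 + a1 *\<^sub>C Y2 d + a2 *\<^sub>C Y3 d + a3 *\<^sub>C Y1 d = a0 *\<^sub>C 1 + a3 *\<^sub>C Y1 d + a1 *\<^sub>C Y2 d + a2 *\<^sub>C Y3 d" for a0 a1 a2 a3
    by (simp add: algebra_simps)
  show "rotate_shear d \<in> quantum_shear h"
    using d unfolding quantum_shear_def rotate_shear_def mem_Collect_eq shear_data.select_convs eq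
    by (elim conjE) (intro conjI; blast)
  show "G12 (rotate_shear d) = G23 d" "G23 (rotate_shear d) = G13 d" "G13 (rotate_shear d) = G12 d"
    by (simp_all add: G12_def G23_def G13_def rotate_shear_def add_ac)
  have "Ginf (rotate_shear d) = Ginf d"
    by (simp add: Ginf_def rotate_shear_def diff_conv_add_uminus add_ac
        del: add_uminus_conv_diff uminus_add_conv_diff)
  then show "omega12 (rotate_shear d) = omega23 d" "omega23 (rotate_shear d) = omega13 d" "omega13 (rotate_shear d) = omega12 d"
    by (simp_all add: omega12_def omega23_def omega13_def rotate_shear_def central_left_commute[OF d])
qed

lemma commutation_G23_G13:
  assumes d: "d \<in> quantum_shear h"
  shows "q_pow h (- 1/2) *\<^sub>C (G23 d * G13 d) - q_pow h (1/2) *\<^sub>C (G13 d * G23 d)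
    = (q_pow h (- 1) - q_pow h 1) *\<^sub>C G12 d + (q_pow h (- 1/2) - q_pow h (1/2)) *\<^sub>C omega12 d"
  using commutation_G12_G23[OF rotate_shear(1)[OF d]] by (simp only: rotate_shear(2-)[OF d])

lemma commutation_G13_G12:
  assumes d: "d \<in> quantum_shear h"
  shows "q_pow h (- 1/2) *\<^sub>C (G13 d * G12 d) - q_pow h (1/2) *\<^sub>C (G12 d * G13 d)
    = (q_pow h (- 1) - q_pow h 1) *\<^sub>C G23 d + (q_pow h (- 1/2) - q_pow h (1/2)) *\<^sub>C omega23 d"
  using commutation_G23_G13[OF rotate_shear(1)[OF d]] by (simp only: rotate_shear(2-)[OF d])

text \<open>Quantum Fricke cubic; the classical constant 4 becomes \<open>q + 1/q + 2\<close>. The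
  right side makes centrality and Hermiticity visible, and read backwards it expresses the square of
  \<open>Ginf\<close>.\<close>

lemma casimir_eq:
  assumes d: "d \<in> quantum_shear h"
  shows "casimir h d = G1 d * G1 d + G2 d * G2 d + G3 d * G3 d + Ginf d * Ginf d
    + G1 d * (G2 d * (G3 d * Ginf d)) - (q_pow h 1 + q_pow h (-1) + 2) *\<^sub>C 1"
proof -
  have two: "2 *\<^sub>C x = x + x" for x :: "'d::complex_inner operator"
    using add_cscale[of 1 1 x] by (simp add: cscale_one)
  have "casimir h d - (G1 d * G1 d + G2 d * G2 d + G3 d * G3 d + Ginf d * Ginf d
      + G1 d * (G2 d * (G3 d * Ginf d))) = (- q_pow h 1 - q_pow h (-1) - 2) *\<^sub>C 1"
    unfolding casimir_def omega13_def omega12_def omega23_def geodesic_shear_exp[OF d] power2_eq_square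
    by (simp add: torus_simps[OF d] two)
  then show ?thesis
    by (simp add: algebra_simps cvs.scale_left_diff_distrib add_cscale)
qed

section \<open>Abstract algebra of the four-holed sphere\<close>

text \<open>
  \<open>p\<close> and \<open>r\<close> stand for \<open>q\<^sup>1\<^sup>/\<^sup>2\<close> and \<open>q\<^sup>-\<^sup>1\<^sup>/\<^sup>2\<close>, and \<open>(X, Y, Z, e)\<close> for
  \<open>(G\<^sub>1\<^sub>2, G\<^sub>2\<^sub>3, G\<^sub>1\<^sub>3, G\<^sub>\<infinity>)\<close>.  The unit \<open>u\<close> of the generated algebra is in general not \<open>1\<close>, since
  observables vanish outside \<^const>\<open>quantum_shear\<close>.
\<close>
locale four_holed_algebra =
  fixes p r :: complex and u X Y Z g1 g2 g3 e :: "'a::complex_algebra"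
  assumes pr: "p * r = 1"
    and unit: "u * u = u"
      "u * X = X" "u * Y = Y" "u * Z = Z" "u * g1 = g1" "u * g2 = g2" "u * g3 = g3" "u * e = e"
      "X * u = X" "Y * u = Y" "Z * u = Z" "g1 * u = g1" "g2 * u = g2" "g3 * u = g3" "e * u = e"
    and central: "X * g1 = g1 * X" "Y * g1 = g1 * Y" "Z * g1 = g1 * Z" "e * g1 = g1 * e"
      "X * g2 = g2 * X" "Y * g2 = g2 * Y" "Z * g2 = g2 * Z" "e * g2 = g2 * e"
      "X * g3 = g3 * X" "Y * g3 = g3 * Y" "Z * g3 = g3 * Z" "e * g3 = g3 * e"
      "X * e = e * X" "Y * e = e * Y" "Z * e = e * Z"
      "g2 * g1 = g1 * g2" "g3 * g1 = g1 * g3" "g3 * g2 = g2 * g3"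
    and rel_XY: "r *\<^sub>C (X * Y) - p *\<^sub>C (Y * X) = (r * r - p * p) *\<^sub>C Z + (r - p) *\<^sub>C (g1 * g3 + g2 * e)"
    and rel_YZ: "r *\<^sub>C (Y * Z) - p *\<^sub>C (Z * Y) = (r * r - p * p) *\<^sub>C X + (r - p) *\<^sub>C (g1 * g2 + g3 * e)"
    and rel_ZX: "r *\<^sub>C (Z * X) - p *\<^sub>C (X * Z) = (r * r - p * p) *\<^sub>C Y + (r - p) *\<^sub>C (g2 * g3 + g1 * e)"
    and rel_casimir: "r *\<^sub>C (X * (Y * Z)) - (r * r) *\<^sub>C (X * X) - (p * p) *\<^sub>C (Y * Y) - (r * r) *\<^sub>C (Z * Z)
        - r *\<^sub>C ((g1 * g2 + g3 * e) * X) - p *\<^sub>C ((g2 * g3 + g1 * e) * Y) - r *\<^sub>C ((g1 * g3 + g2 * e) * Z)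
      = g1 * g1 + g2 * g2 + g3 * g3 + e * e + g1 * (g2 * (g3 * e)) - (p * p + r * r + 2) *\<^sub>C u"
begin

lemma pr_simps: "r * p = 1" "p * (r * c) = c" "r * (p * c) = c"
  using pr by (metis mult.commute mult.assoc mult_1)+

lemma swap_YX: "Y * X = (r * r) *\<^sub>C (X * Y) - (r * (r * r - p * p)) *\<^sub>C Z - (r * (r - p)) *\<^sub>C (g1 * g3 + g2 * e)"
proof -
  have "p *\<^sub>C (Y * X) = r *\<^sub>C (X * Y) - (r * r - p * p) *\<^sub>C Z - (r - p) *\<^sub>C (g1 * g3 + g2 * e)"
    using rel_XY by (simp add: algebra_simps)
  from arg_cong[OF this, of "\<lambda>x. r *\<^sub>C x"] show ?thesis
    by (simp add: cscale_cscale cvs.scale_right_diff_distrib pr_simps(1) cscale_one)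
qed

lemma swap_ZY: "Z * Y = (r * r) *\<^sub>C (Y * Z) - (r * (r * r - p * p)) *\<^sub>C X - (r * (r - p)) *\<^sub>C (g1 * g2 + g3 * e)"
proof -
  have "p *\<^sub>C (Z * Y) = r *\<^sub>C (Y * Z) - (r * r - p * p) *\<^sub>C X - (r - p) *\<^sub>C (g1 * g2 + g3 * e)"
    using rel_YZ by (simp add: algebra_simps)
  from arg_cong[OF this, of "\<lambda>x. r *\<^sub>C x"] show ?thesis
    by (simp add: cscale_cscale cvs.scale_right_diff_distrib pr_simps(1) cscale_one)
qed

lemma swap_ZX: "Z * X = (p * p) *\<^sub>C (X * Z) + (p * (r * r - p * p)) *\<^sub>C Y + (p * (r - p)) *\<^sub>C (g2 * g3 + g1 * e)"
proof -
  have "r *\<^sub>C (Z * X) = p *\<^sub>C (X * Z) + (r * r - p * p) *\<^sub>C Y + (r - p) *\<^sub>C (g2 * g3 + g1 * e)"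
    using rel_ZX by (simp add: algebra_simps)
  from arg_cong[OF this, of "\<lambda>x. p *\<^sub>C x"] show ?thesis
    by (simp add: cscale_cscale cscale_add pr cscale_one)
qed

lemma mult_left_rule: "x * y = z \<Longrightarrow> x * (y * t) = z * t" for x y z t :: 'a
  by (simp flip: mult.assoc)

lemmas swap_left = swap_YX[THEN mult_left_rule] swap_ZY[THEN mult_left_rule] swap_ZX[THEN mult_left_rule]

lemmas central_left = central[THEN mult_left_rule, unfolded mult.assoc]

lemmas expand_simps =
  distrib_left distrib_right left_diff_distrib right_diff_distrib cscale_mult_left cscale_mult_right mult.assoc cscale_add cscale_cscale
  cvs.scale_left_diff_distrib cvs.scale_right_diff_distrib add_cscale cscale_one
  pr pr_simps unit unit[THEN mult_left_rule] central central_left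

text \<open>Orientation of the relations: letters are sorted as \<open>X\<close>, \<open>Y\<close>,
  \<open>Z\<close>, with lower-order terms from the commutators.\<close>

lemmas normal_simps = expand_simps swap_YX swap_ZY swap_ZX swap_left

text \<open>The Casimir is not visibly cyclic, since its powers of \<open>q\<close> depend on the
  order of the letters. Its central value is replaced by the unrotated Casimir, and both sides are
  then sorted.\<close>

lemma four_holed_algebra_rotate: "four_holed_algebra p r u Y Z X g2 g3 g1 e"
proof
  show "r *\<^sub>C (Y * (Z * X)) - (r * r) *\<^sub>C (Y * Y) - (p * p) *\<^sub>C (Z * Z) - (r * r) *\<^sub>C (X * X)
        - r *\<^sub>C ((g2 * g3 + g1 * e) * Y) - p *\<^sub>C ((g3 * g1 + g2 * e) * Z) - r *\<^sub>C ((g2 * g1 + g3 * e) * X)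
      = g2 * g2 + g3 * g3 + g1 * g1 + e * e + g2 * (g3 * (g1 * e)) - (p * p + r * r + 2) *\<^sub>C u" (is "?c = ?k")
  proof -
    have "?c = g1 * g1 + g2 * g2 + g3 * g3 + e * e + g1 * (g2 * (g3 * e)) - (p * p + r * r + 2) *\<^sub>C u"
      unfolding rel_casimir[symmetric] by (simp add: normal_simps)
    also have "\<dots> = ?k"
      by (simp add: central central_left)
    finally show ?thesis .
  qed
qed (use rel_XY rel_YZ rel_ZX in \<open>simp_all add: pr unit central\<close>)

text \<open>The prospective images under the exchange of the first two holes obey the presentation
  again. This is the algebraic content of that braid generator being a homomorphism.\<close>

lemma four_holed_algebra_braid:
  "four_holed_algebra p r u X Z (p *\<^sub>C (X * Z) - (p * p) *\<^sub>C Y - p *\<^sub>C (g2 * g3 + g1 * e)) g2 g1 g3 e"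
  (is "four_holed_algebra p r u X Z ?Z _ _ _ _")
proof
  show "r *\<^sub>C (X * (Z * ?Z)) - (r * r) *\<^sub>C (X * X) - (p * p) *\<^sub>C (Z * Z) - (r * r) *\<^sub>C (?Z * ?Z)
        - r *\<^sub>C ((g2 * g1 + g3 * e) * X) - p *\<^sub>C ((g1 * g3 + g2 * e) * Z) - r *\<^sub>C ((g2 * g3 + g1 * e) * ?Z)
      = g2 * g2 + g1 * g1 + g3 * g3 + e * e + g2 * (g1 * (g3 * e)) - (p * p + r * r + 2) *\<^sub>C u" (is "?c = ?k")
  proof -
    have "?c = g1 * g1 + g2 * g2 + g3 * g3 + e * e + g1 * (g2 * (g3 * e)) - (p * p + r * r + 2) *\<^sub>C u"
      unfolding rel_casimir[symmetric] by (simp add: normal_simps)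
    also have "\<dots> = ?k"
      by (simp add: central central_left)
    finally show ?thesis .
  qed
qed (simp_all add: normal_simps)

text \<open>The second braid generator is the first one conjugated by the cyclic rotation: rotate
  once, braid, rotate twice more. No new sorting computation arises.\<close>

lemma four_holed_algebra_braid':
  "four_holed_algebra p r u (p *\<^sub>C (Y * X) - (p * p) *\<^sub>C Z - p *\<^sub>C (g1 * g3 + g2 * e)) Y X g1 g3 g2 e"
proof -
  interpret rot: four_holed_algebra p r u Y Z X g2 g3 g1 e
    by (rule four_holed_algebra_rotate)
  interpret rot2: four_holed_algebra p r u Y X "p *\<^sub>C (Y * X) - (p * p) *\<^sub>C Z - p *\<^sub>C (g3 * g1 + g2 * e)" g3 g2 g1 e
    by (rule rot.four_holed_algebra_braid)
  interpret rot3: four_holed_algebra p r u X "p *\<^sub>C (Y * X) - (p * p) *\<^sub>C Z - p *\<^sub>C (g3 * g1 + g2 * e)" Y g2 g1 g3 e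
    by (rule rot2.four_holed_algebra_rotate)
  show ?thesis
    using rot3.four_holed_algebra_rotate by (simp add: central)
qed

lemma braid_generator_alt:
  "p *\<^sub>C (X * Z) - (p * p) *\<^sub>C Y - p *\<^sub>C (g2 * g3 + g1 * e) = r *\<^sub>C (Z * X) - (r * r) *\<^sub>C Y - r *\<^sub>C (g2 * g3 + g1 * e)"
  "p *\<^sub>C (Y * X) - (p * p) *\<^sub>C Z - p *\<^sub>C (g1 * g3 + g2 * e) = r *\<^sub>C (X * Y) - (r * r) *\<^sub>C Z - r *\<^sub>C (g1 * g3 + g2 * e)"
  by (simp_all add: normal_simps)

text \<open>The left side is the image under the first braid generator of what the second one makes
  of \<open>X\<close>. Its being \<open>Y\<close> turns the composite of the two into the rotation
  \<open>X\<close> to \<open>Y\<close> to \<open>Z\<close> to \<open>X\<close>.\<close>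

lemma braid_generator_inverse:
  "p *\<^sub>C (Z * X) - (p * p) *\<^sub>C (p *\<^sub>C (X * Z) - (p * p) *\<^sub>C Y - p *\<^sub>C (g2 * g3 + g1 * e)) - p *\<^sub>C (g2 * g3 + g1 * e) = Y"
  by (simp add: normal_simps)

section \<open>Reduction to ordered monomials\<close>

definition centrals :: "'a set" where
  "centrals = {g1 ^ i * (g2 ^ j * (g3 ^ k * u)) | i j k. True}"

definition pbw :: "nat \<Rightarrow> nat \<Rightarrow> nat \<Rightarrow> nat \<Rightarrow> 'a \<Rightarrow> 'a" where
  "pbw a b c l \<kappa> = X ^ a * (Y ^ b * (Z ^ c * (e ^ l * \<kappa>)))"

text \<open>The weights 2 and 3 are the total degrees of the leading terms in the exponentials of the
  \<open>Y\<^sub>i\<close>; with them both sides of the Casimir relation have weight 6, and rewriting \<open>e * e\<close>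
  does not increase the weight.\<close>
definition normal_forms :: "nat \<Rightarrow> 'a set" where
  "normal_forms n = {pbw a b c l \<kappa> | a b c l \<kappa>. \<kappa> \<in> centrals \<and> l \<le> 1 \<and> 2 * (a + b + c) + 3 * l \<le> n}"

definition filt :: "nat \<Rightarrow> 'a set" where
  "filt n = cvs.span (normal_forms n)"

lemma filt_mono: "m \<le> n \<Longrightarrow> x \<in> filt m \<Longrightarrow> x \<in> filt n"
  unfolding filt_def using cvs.span_mono[of "normal_forms m" "normal_forms n"]
  by (fastforce simp: normal_forms_def)

lemma filt_closed [intro]:
  "x \<in> filt n \<Longrightarrow> y \<in> filt n \<Longrightarrow> x + y \<in> filt n"
  "x \<in> filt n \<Longrightarrow> y \<in> filt n \<Longrightarrow> x - y \<in> filt n"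
  "x \<in> filt n \<Longrightarrow> s *\<^sub>C x \<in> filt n"
  unfolding filt_def by (rule cvs.span_add cvs.span_diff cvs.span_scale; assumption)+

lemma filt_pbwI:
  "\<kappa> \<in> centrals \<Longrightarrow> l \<le> 1 \<Longrightarrow> 2 * (a + b + c) + 3 * l \<le> n \<Longrightarrow> pbw a b c l \<kappa> \<in> filt n"
  unfolding filt_def normal_forms_def by (rule cvs.span_base) blast

lemma filt_mult_left:
  assumes "x \<in> filt n"
    and "\<And>a b c l \<kappa>. \<kappa> \<in> centrals \<Longrightarrow> l \<le> 1 \<Longrightarrow> 2 * (a + b + c) + 3 * l \<le> n \<Longrightarrow> y * pbw a b c l \<kappa> \<in> filt m"
  shows "y * x \<in> filt m"
  using assms(1) unfolding filt_def
proof (induction rule: cvs.span_induct)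
  case base
  show ?case
    unfolding cvs.subspace_def
    by (simp add: distrib_left cscale_mult_right cvs.span_zero cvs.span_add cvs.span_scale)
next
  case (step x)
  then obtain a b c l \<kappa> where "x = pbw a b c l \<kappa>" "\<kappa> \<in> centrals" "l \<le> 1" "2 * (a + b + c) + 3 * l \<le> n"
    unfolding normal_forms_def by blast
  then show ?case
    using assms(2)[unfolded filt_def] by simp
qed

lemma commute_power: "x * y = y * x \<Longrightarrow> x * (y ^ n * t) = y ^ n * (x * t)" for x y t :: 'a
  using power_commuting_commutes[of y x n] by (simp flip: mult.assoc)

lemma commute_pbw:
  assumes "x * X = X * x" "x * Y = Y * x" "x * Z = Z * x" "x * e = e * x"
  shows "x * pbw a b c l \<kappa> = pbw a b c l (x * \<kappa>)"
  unfolding pbw_def by (simp only: commute_power[OF assms(1)] commute_power[OF assms(2)]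
      commute_power[OF assms(3)] commute_power[OF assms(4)])

lemma centrals_mult: "\<kappa> \<in> centrals \<Longrightarrow> g \<in> {g1, g2, g3} \<Longrightarrow> g * \<kappa> \<in> centrals"
proof -
  assume "\<kappa> \<in> centrals" "g \<in> {g1, g2, g3}"
  then obtain i j k where \<kappa>: "\<kappa> = g1 ^ i * (g2 ^ j * (g3 ^ k * u))"
    unfolding centrals_def by blast
  have "g1 * \<kappa> = g1 ^ Suc i * (g2 ^ j * (g3 ^ k * u))"
    by (simp add: \<kappa> mult.assoc)
  moreover have "g2 * \<kappa> = g1 ^ i * (g2 ^ Suc j * (g3 ^ k * u))"
    by (simp add: \<kappa> mult.assoc commute_power[OF central(16)])
  moreover have "g3 * \<kappa> = g1 ^ i * (g2 ^ j * (g3 ^ Suc k * u))"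
    by (simp add: \<kappa> mult.assoc commute_power[OF central(17)] commute_power[OF central(18)])
  ultimately show ?thesis
    using \<open>g \<in> _\<close> unfolding centrals_def by blast
qed

lemma filt_g:
  assumes "x \<in> filt n" "g \<in> {g1, g2, g3}"
  shows "g * x \<in> filt n"
proof (rule filt_mult_left[OF assms(1)])
  fix a b c l \<kappa>
  assume *: "\<kappa> \<in> centrals" "l \<le> 1" "2 * (a + b + c) + 3 * l \<le> n"
  have "g * pbw a b c l \<kappa> = pbw a b c l (g * \<kappa>)"
    by (rule commute_pbw) (use assms(2) central in auto)
  then show "g * pbw a b c l \<kappa> \<in> filt n"
    using * filt_pbwI centrals_mult assms(2) by auto
qed

lemma pbw_X: "X * pbw a b c l \<kappa> = pbw (Suc a) b c l \<kappa>"
  by (simp add: pbw_def mult.assoc)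

lemma filt_X: "x \<in> filt n \<Longrightarrow> X * x \<in> filt (n + 2)"
  by (erule filt_mult_left) (auto simp: pbw_X intro!: filt_pbwI)

lemma e_squared:
  "e * e = r *\<^sub>C (X * (Y * Z)) - (r * r) *\<^sub>C (X * X) - (p * p) *\<^sub>C (Y * Y) - (r * r) *\<^sub>C (Z * Z)
    - r *\<^sub>C ((g1 * g2 + g3 * e) * X) - p *\<^sub>C ((g2 * g3 + g1 * e) * Y) - r *\<^sub>C ((g1 * g3 + g2 * e) * Z)
    - g1 * g1 - g2 * g2 - g3 * g3 - g1 * (g2 * (g3 * e)) + (p * p + r * r + 2) *\<^sub>C u"
  unfolding rel_casimir by (simp add: algebra_simps)

lemma unit_pbw: "\<kappa> \<in> centrals \<Longrightarrow> u * pbw a b c l \<kappa> = pbw a b c l \<kappa>"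
proof -
  assume "\<kappa> \<in> centrals"
  moreover have "u * g1 = g1 * u" "u * g2 = g2 * u" "u * g3 = g3 * u"
    by (simp_all add: unit)
  ultimately have "u * \<kappa> = \<kappa>"
    by (auto simp: centrals_def commute_power[of u g1] commute_power[of u g2] commute_power[of u g3] unit(1))
  then show ?thesis
    by (simp add: commute_pbw unit)
qed

text \<open>The three claims must be proved together: sorting \<open>Y\<close> or \<open>Z\<close>
  past earlier letters creates the other letters and \<open>e\<close>, and reducing
  \<open>e * e\<close> creates all of them, in each case applied to elements of smaller weight.
  \<open>X\<close> stands first in the order and needs no sorting, so it stays outside the
  induction.\<close>

lemma filt_Y_Z_e:
  "(\<forall>x\<in>filt n. Y * x \<in> filt (n + 2)) \<and> (\<forall>x\<in>filt n. Z * x \<in> filt (n + 2)) \<and> (\<forall>x\<in>filt n. e * x \<in> filt (n + 3))"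
proof (induction n rule: less_induct)
  case (less n)
  have Y: "Y * x \<in> filt (m + 2)" and Z: "Z * x \<in> filt (m + 2)" and E: "e * x \<in> filt (m + 3)"
    if "x \<in> filt m" "m < n" for x m
    using less.IH[OF that(2)] that(1) by blast+
  note X = filt_X and G1 = filt_g[where g = g1, simplified] and G2 = filt_g[where g = g2, simplified]
    and G3 = filt_g[where g = g3, simplified]
  have Yn: "Y * x \<in> filt (n + 2)" if "x \<in> filt n" for x
  proof (rule filt_mult_left[OF that])
    fix a b c l \<kappa>
    assume *: "\<kappa> \<in> centrals" "l \<le> 1" "2 * (a + b + c) + 3 * l \<le> n"
    show "Y * pbw a b c l \<kappa> \<in> filt (n + 2)"
    proof (cases a)
      case 0
      then have "Y * pbw a b c l \<kappa> = pbw a (Suc b) c l \<kappa>"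
        by (simp add: pbw_def mult.assoc)
      then show ?thesis
        using * filt_pbwI by simp
    next
      case (Suc a')
      define x where "x = pbw a' b c l \<kappa>"
      define m where "m = n - 2"
      have n: "n = m + 2" and "m < n"
        using * Suc by (auto simp: m_def)
      have x: "x \<in> filt m"
        unfolding x_def using * Suc n by (auto intro!: filt_pbwI)
      note up = filt_mono[where n = "n + 2"]
      have "Y * pbw a b c l \<kappa> = Y * (X * x)"
        by (simp add: x_def pbw_X Suc)
      also have "\<dots> = (r * r) *\<^sub>C (X * (Y * x)) - (r * (r * r - p * p)) *\<^sub>C (Z * x)
          - (r * (r - p)) *\<^sub>C (g1 * (g3 * x) + g2 * (e * x))"
        unfolding swap_YX[THEN mult_left_rule]
        by (simp only: distrib_right left_diff_distrib cscale_mult_left mult.assoc)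
      also have "\<dots> \<in> filt (n + 2)"
        using up[OF _ X[OF Y[OF x \<open>m < n\<close>]]] up[OF _ Z[OF x \<open>m < n\<close>]] up[OF _ G1[OF G3[OF x]]]
          up[OF _ G2[OF E[OF x \<open>m < n\<close>]]]
        by (intro filt_closed) (simp_all add: n)
      finally show ?thesis .
    qed
  qed
  have Zn: "Z * x \<in> filt (n + 2)" if "x \<in> filt n" for x
  proof (rule filt_mult_left[OF that])
    fix a b c l \<kappa>
    assume *: "\<kappa> \<in> centrals" "l \<le> 1" "2 * (a + b + c) + 3 * l \<le> n"
    consider "a = 0" "b = 0" | b' where "a = 0" "b = Suc b'" | a' where "a = Suc a'"
      by (metis not0_implies_Suc)
    then show "Z * pbw a b c l \<kappa> \<in> filt (n + 2)"
    proof cases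
      case 1
      then have "Z * pbw a b c l \<kappa> = pbw a b (Suc c) l \<kappa>"
        by (simp add: pbw_def mult.assoc)
      then show ?thesis
        using * filt_pbwI by simp
    next
      case 2
      define x where "x = pbw 0 b' c l \<kappa>"
      define m where "m = n - 2"
      have n: "n = m + 2" and "m < n"
        using * 2 by (auto simp: m_def)
      have x: "x \<in> filt m"
        unfolding x_def using * 2 n by (auto intro!: filt_pbwI)
      note up = filt_mono[where n = "n + 2"]
      \<comment> \<open>This product again has weight \<open>n\<close>, so the induction hypothesis
        for \<open>Y\<close> does not reach it; \<open>Yn\<close>, already proved at the present
        weight, does.\<close>
      have "Z * x \<in> filt n"
        using Z[OF x \<open>m < n\<close>] by (simp add: n)
      then have YZ: "Y * (Z * x) \<in> filt (n + 2)"
        by (rule Yn)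
      have "Z * pbw a b c l \<kappa> = Z * (Y * x)"
        by (simp add: x_def pbw_def mult.assoc 2)
      also have "\<dots> = (r * r) *\<^sub>C (Y * (Z * x)) - (r * (r * r - p * p)) *\<^sub>C (X * x)
          - (r * (r - p)) *\<^sub>C (g1 * (g2 * x) + g3 * (e * x))"
        unfolding swap_ZY[THEN mult_left_rule]
        by (simp only: distrib_right left_diff_distrib cscale_mult_left mult.assoc)
      also have "\<dots> \<in> filt (n + 2)"
        using YZ up[OF _ X[OF x]] up[OF _ G1[OF G2[OF x]]] up[OF _ G3[OF E[OF x \<open>m < n\<close>]]]
        by (intro filt_closed) (simp_all add: n)
      finally show ?thesis .
    next
      case 3
      define x where "x = pbw a' b c l \<kappa>"
      define m where "m = n - 2"
      have n: "n = m + 2" and "m < n"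
        using * 3 by (auto simp: m_def)
      have x: "x \<in> filt m"
        unfolding x_def using * 3 n by (auto intro!: filt_pbwI)
      note up = filt_mono[where n = "n + 2"]
      have "Z * pbw a b c l \<kappa> = Z * (X * x)"
        by (simp add: x_def pbw_X 3)
      also have "\<dots> = (p * p) *\<^sub>C (X * (Z * x)) + (p * (r * r - p * p)) *\<^sub>C (Y * x)
          + (p * (r - p)) *\<^sub>C (g2 * (g3 * x) + g1 * (e * x))"
        unfolding swap_ZX[THEN mult_left_rule]
        by (simp only: distrib_right left_diff_distrib cscale_mult_left mult.assoc)
      also have "\<dots> \<in> filt (n + 2)"
        using up[OF _ X[OF Z[OF x \<open>m < n\<close>]]] up[OF _ Y[OF x \<open>m < n\<close>]] up[OF _ G2[OF G3[OF x]]]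
          up[OF _ G1[OF E[OF x \<open>m < n\<close>]]]
        by (intro filt_closed) (simp_all add: n)
      finally show ?thesis .
    qed
  qed
  have En: "e * x \<in> filt (n + 3)" if "x \<in> filt n" for x
  proof (rule filt_mult_left[OF that])
    fix a b c l \<kappa>
    assume *: "\<kappa> \<in> centrals" "l \<le> 1" "2 * (a + b + c) + 3 * l \<le> n"
    have swap: "e * pbw a b c l' \<kappa> = pbw a b c (Suc l') \<kappa>" for l'
      using commute_pbw[of e a b c l' \<kappa>] by (simp add: central pbw_def power_Suc2 mult.assoc del: power_Suc)
    show "e * pbw a b c l \<kappa> \<in> filt (n + 3)"
    proof (cases "l = 0")
      case True
      then show ?thesis
        unfolding swap using * by (intro filt_pbwI) auto
    next
      case False
      then have l: "l = Suc 0" using * by simp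
      define x where "x = pbw a b c 0 \<kappa>"
      define m where "m = n - 3"
      have n: "n = m + 3"
        using * l by (simp add: m_def)
      have x: "x \<in> filt m" and ux: "u * x = x"
        unfolding x_def using * l n unit_pbw by (auto intro!: filt_pbwI)
      \<comment> \<open>Weight 3 for \<open>e\<close> leaves room for one letter before the second
        use of the induction hypothesis, as \<open>m + 2 < n\<close>. The third letter of the cubic
        term is the unrestricted \<open>X\<close>.\<close>
      have less: "m < n" "m + 2 < n" by (simp_all add: n)
      note Xx = X[OF x] and Yx = Y[OF x less(1)] and Zx = Z[OF x less(1)]
      note up = filt_mono[where n = "n + 3"]
      have "e * pbw a b c l \<kappa> = (e * e) * x"
        by (simp add: x_def l swap mult.assoc)
      also have "\<dots> = r *\<^sub>C (X * (Y * (Z * x))) - (r * r) *\<^sub>C (X * (X * x)) - (p * p) *\<^sub>C (Y * (Y * x))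
          - (r * r) *\<^sub>C (Z * (Z * x))
          - r *\<^sub>C (g1 * (g2 * (X * x)) + g3 * (e * (X * x)))
          - p *\<^sub>C (g2 * (g3 * (Y * x)) + g1 * (e * (Y * x)))
          - r *\<^sub>C (g1 * (g3 * (Z * x)) + g2 * (e * (Z * x)))
          - g1 * (g1 * x) - g2 * (g2 * x) - g3 * (g3 * x) - g1 * (g2 * (g3 * (e * x)))
          + (p * p + r * r + 2) *\<^sub>C (u * x)"
        unfolding e_squared by (simp only: distrib_right left_diff_distrib cscale_mult_left mult.assoc)
      also have "\<dots> \<in> filt (n + 3)"
        unfolding ux using up[OF _ X[OF Y[OF Zx less(2)]]] up[OF _ X[OF Xx]] up[OF _ Y[OF Yx less(2)]]
          up[OF _ Z[OF Zx less(2)]] up[OF _ G1[OF G2[OF Xx]]] up[OF _ G3[OF E[OF Xx less(2)]]]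
          up[OF _ G2[OF G3[OF Yx]]] up[OF _ G1[OF E[OF Yx less(2)]]] up[OF _ G1[OF G3[OF Zx]]]
          up[OF _ G2[OF E[OF Zx less(2)]]] up[OF _ G1[OF G1[OF x]]] up[OF _ G2[OF G2[OF x]]]
          up[OF _ G3[OF G3[OF x]]] up[OF _ G1[OF G2[OF G3[OF E[OF x less(1)]]]]] up[OF _ x]
        by (intro filt_closed) (simp_all add: n)
      finally show ?thesis .
    qed
  qed
  show ?case
    using Yn Zn En by blast
qed

text \<open>Left multiplication by each generator preserves the union of the filtration, hence so
  does every element of the algebra. Applying it to the unit gives the element itself; that
  \<open>u\<close> is neutral is carried along in the same induction.\<close>

lemma generated_algebra_filt:
  assumes "x \<in> generated_algebra u {X, Y, Z, g1, g2, g3, e}"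
  shows "\<exists>n. x \<in> filt n"
proof -
  have unit_filt: "u * x = x" if "x \<in> filt n" for x n
    using that unfolding filt_def
  proof (induction rule: cvs.span_induct)
    case base
    show ?case by (rule cvs.subspaceI) (auto simp: distrib_left cscale_mult_right)
  next
    case (step x)
    then show ?case unfolding normal_forms_def using unit_pbw by auto
  qed
  note uu = unit(1) and uu' = unit(2-)
  have "u \<in> centrals"
    unfolding centrals_def by (auto intro!: exI[of _ 0])
  then have u: "u \<in> filt 0"
    using filt_pbwI[of u 0 0 0 0 0] by (simp add: pbw_def)
  have "(\<exists>n. x * y \<in> filt n) \<and> u * x = x \<and> x * u = x" if "y \<in> filt m" for y m
    using assms that
  proof (induction arbitrary: y m)
    case unit
    then show ?case using unit_filt[OF \<open>y \<in> filt m\<close>] uu by auto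
  next
    case (generator x)
    have "X * y \<in> filt (m + 3)" "Y * y \<in> filt (m + 3)" "Z * y \<in> filt (m + 3)" "e * y \<in> filt (m + 3)"
      using filt_Y_Z_e[of m] filt_X[OF generator.prems] generator.prems filt_mono[of "m + 2" "m + 3"] by simp_all
    moreover have "g * y \<in> filt (m + 3)" if "g \<in> {g1, g2, g3}" for g
      using filt_mono[OF _ filt_g[OF generator.prems that], of "m + 3"] by simp
    ultimately have "x * y \<in> filt (m + 3)"
      using generator.hyps by blast
    moreover have "u * x = x" "x * u = x"
      using generator.hyps uu' by blast+
    ultimately show ?case
      by blast
  next
    case (add x1 x2)
    obtain n1 n2 where "x1 * y \<in> filt n1" "x2 * y \<in> filt n2"
      using add by blast
    then have "x1 * y + x2 * y \<in> filt (max n1 n2)"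
      using filt_mono[OF max.cobounded1] filt_mono[OF max.cobounded2] by blast
    then show ?case
      using add by (auto simp: distrib_left distrib_right)
  next
    case (mult x1 x2)
    obtain n where "x2 * y \<in> filt n"
      using mult by blast
    then have "\<exists>n. x1 * (x2 * y) \<in> filt n"
      using mult.IH(1) by blast
    moreover have "u * x1 = x1" "x2 * u = x2"
      using mult.IH[OF u] by auto
    ultimately show ?case
      using mult_left_rule[of u x1 x1 x2] by (simp add: mult.assoc)
  next
    case (scale x c)
    obtain n where "x * y \<in> filt n"
      using scale by blast
    then have "(c *\<^sub>C x) * y \<in> filt n"
      by (simp add: cscale_mult_left filt_closed(3))
    then show ?case
      using scale by (auto simp: cscale_mult_left cscale_mult_right)
  qed
  from this[OF u] show ?thesis by metis
qed

end

section \<open>Exponential growth along curves of shear data\<close>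

text \<open>Finite exponential sums with operator coefficients. Growth is a matter of form here,
  since unbounded operators have no norm to estimate.\<close>

inductive_set low :: "real \<Rightarrow> (real \<Rightarrow> 'a::complex_algebra) set" for v :: real where
  low_zero: "(\<lambda>t. 0) \<in> low v"
| low_step: "f \<in> low v \<Longrightarrow> \<mu> < v \<Longrightarrow> (\<lambda>t. f t + complex_of_real (exp (t * \<mu>)) *\<^sub>C B) \<in> low v"

definition lead :: "real \<Rightarrow> 'a::complex_algebra \<Rightarrow> (real \<Rightarrow> 'a) set" where
  "lead v A = {f. (\<lambda>t. f t - complex_of_real (exp (t * v)) *\<^sub>C A) \<in> low v}"

lemma low_exp: "\<mu> < v \<Longrightarrow> (\<lambda>t. complex_of_real (exp (t * \<mu>)) *\<^sub>C B) \<in> low v"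
  using low_step[OF low_zero, of \<mu> v B] by simp

lemma low_add: "f \<in> low v \<Longrightarrow> g \<in> low v \<Longrightarrow> (\<lambda>t. f t + g t) \<in> low v"
proof (induction rule: low.induct)
  case (low_step f \<mu> B)
  then have "(\<lambda>t. (f t + g t) + complex_of_real (exp (t * \<mu>)) *\<^sub>C B) \<in> low v"
    by (intro low.low_step) auto
  then show ?case
    by (simp add: add_ac)
qed simp

lemma low_mono: "f \<in> low v \<Longrightarrow> v \<le> w \<Longrightarrow> f \<in> low w"
  by (induction rule: low.induct) (auto intro: low.intros)

lemma low_mult_exp:
  assumes "f \<in> low v"
  shows "(\<lambda>t. complex_of_real (exp (t * \<mu>)) *\<^sub>C B * f t) \<in> low (\<mu> + v)"
    and "(\<lambda>t. f t * complex_of_real (exp (t * \<mu>)) *\<^sub>C B) \<in> low (\<mu> + v)"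
  using assms
proof (induction rule: low.induct)
  case low_zero
  { case 1 show ?case by (simp add: low.low_zero)
  next case 2 show ?case by (simp add: low.low_zero) }
next
  case (low_step f \<nu> C)
  have e: "complex_of_real (exp (t * \<mu>)) * complex_of_real (exp (t * \<nu>)) = complex_of_real (exp (t * (\<mu> + \<nu>)))" for t
    by (simp add: distrib_left exp_add)
  have e': "complex_of_real (exp (t * \<nu>)) * complex_of_real (exp (t * \<mu>)) = complex_of_real (exp (t * (\<mu> + \<nu>)))" for t
    by (simp add: distrib_left exp_add)
  { case 1
    have "(\<lambda>t. complex_of_real (exp (t * \<mu>)) *\<^sub>C B * f t + complex_of_real (exp (t * (\<mu> + \<nu>))) *\<^sub>C (B * C)) \<in> low (\<mu> + v)"
      using low_step by (intro low.low_step) auto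
    then show ?case
      by (simp only: distrib_left cscale_mult_left cscale_mult_right cscale_cscale cscale_add e e')
  next
    case 2
    have "(\<lambda>t. f t * complex_of_real (exp (t * \<mu>)) *\<^sub>C B + complex_of_real (exp (t * (\<mu> + \<nu>))) *\<^sub>C (C * B)) \<in> low (\<mu> + v)"
      using low_step by (intro low.low_step) auto
    then show ?case
      by (simp only: distrib_right cscale_add cscale_mult_left cscale_mult_right cscale_cscale e e') }
qed

lemma low_mult: "f \<in> low v \<Longrightarrow> g \<in> low w \<Longrightarrow> (\<lambda>t. f t * g t) \<in> low (v + w)"
proof (induction rule: low.induct)
  case (low_step f \<mu> B)
  have "(\<lambda>t. complex_of_real (exp (t * \<mu>)) *\<^sub>C B * g t) \<in> low (v + w)"
    using low_mono[OF low_mult_exp(1)[OF low_step.prems, of \<mu> B]] low_step.hyps by simp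
  from low_add[OF low_step.IH[OF low_step.prems] this] show ?case
    by (simp add: distrib_right)
qed (simp add: low_zero)

lemma lead_exp: "(\<lambda>t. complex_of_real (exp (t * v)) *\<^sub>C A) \<in> lead v A"
  by (simp add: lead_def low_zero)

lemma lead_add_low: "f \<in> lead v A \<Longrightarrow> g \<in> low v \<Longrightarrow> (\<lambda>t. f t + g t) \<in> lead v A"
  using low_add[of "\<lambda>t. f t - complex_of_real (exp (t * v)) *\<^sub>C A" v g] by (simp add: lead_def algebra_simps)

lemma lead_low: "f \<in> lead v A \<Longrightarrow> v < w \<Longrightarrow> f \<in> low w"
  using low_add[OF low_mono low_exp, of "\<lambda>t. f t - complex_of_real (exp (t * v)) *\<^sub>C A" v w v A]
  by (simp add: lead_def)

lemma lead_mult: "f \<in> lead v A \<Longrightarrow> g \<in> lead w B \<Longrightarrow> (\<lambda>t. f t * g t) \<in> lead (v + w) (A * B)"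
proof -
  assume f: "f \<in> lead v A" and g: "g \<in> lead w B"
  define f' g' where "f' = (\<lambda>t. f t - complex_of_real (exp (t * v)) *\<^sub>C A)" and "g' = (\<lambda>t. g t - complex_of_real (exp (t * w)) *\<^sub>C B)"
  have f': "f' \<in> low v" and g': "g' \<in> low w"
    using f g by (simp_all add: f'_def g'_def lead_def)
  have eq: "f t * g t - complex_of_real (exp (t * (v + w))) *\<^sub>C (A * B)
      = f' t * g' t + f' t * complex_of_real (exp (t * w)) *\<^sub>C B + complex_of_real (exp (t * v)) *\<^sub>C A * g' t" for t
    unfolding f'_def g'_def distrib_left exp_add of_real_mult
    by (simp add: algebra_simps cscale_mult_left cscale_mult_right cscale_cscale)
  have "(\<lambda>t. f' t * complex_of_real (exp (t * w)) *\<^sub>C B) \<in> low (v + w)"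
    using low_mult_exp(2)[OF f', of w B] by (simp add: add.commute)
  then show ?thesis
    unfolding lead_def using low_add[OF low_add[OF low_mult[OF f' g']] low_mult_exp(1)[OF g', of v A]]
    by (simp add: eq)
qed

lemma lead_one: "(\<lambda>t. 1) \<in> lead 0 1"
  using lead_exp[of 0 1] by (simp add: cscale_one)

lemma lead_power: "f \<in> lead v A \<Longrightarrow> (\<lambda>t. f t ^ n) \<in> lead (real n * v) (A ^ n)"
proof (induction n)
  case (Suc n)
  from lead_mult[OF Suc.prems Suc.IH[OF Suc.prems]] show ?case
    by (simp add: algebra_simps)
qed (simp add: lead_one)

lemma lead_scale: "f \<in> lead v A \<Longrightarrow> (\<lambda>t. c *\<^sub>C f t) \<in> lead v (c *\<^sub>C A)"
  using lead_mult[OF lead_exp[of 0 "c *\<^sub>C 1"]] by (fastforce simp: cscale_mult_left cscale_one)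

lemma low_tendsto:
  assumes "f \<in> low v"
  shows "((\<lambda>t. exp (- (t * v)) *\<^sub>R apply_op (f t) x) \<longlongrightarrow> 0) at_top"
  using assms
proof (induction rule: low.induct)
  case (low_step f \<mu> B)
  have "LIM t at_top. (\<mu> - v) * t :> at_bot"
    using low_step.hyps by (intro filterlim_tendsto_neg_mult_at_bot[OF tendsto_const] filterlim_ident) auto
  then have "((\<lambda>t. exp ((\<mu> - v) * t)) \<longlongrightarrow> 0) at_top"
    by (rule filterlim_compose[OF exp_at_bot])
  from tendsto_add[OF low_step.IH tendsto_scaleR[OF this tendsto_const[of "apply_op B x"]]] show ?case
    by (simp add: scaleR_add_right algebra_simps flip: scaleR_scaleC exp_add)
qed simp

text \<open>After division by the leading exponential the remainder vanishes in the limit on every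
  vector, and only \<open>A\<close> survives.\<close>

lemma lead_eq_0:
  fixes f :: "real \<Rightarrow> 'd::complex_inner operator"
  assumes "f \<in> lead v A" and "\<And>t. f t = 0"
  shows "A = 0"
proof (rule operator_eqI)
  fix x
  define g where "g = (\<lambda>t. f t - complex_of_real (exp (t * v)) *\<^sub>C A)"
  have "((\<lambda>t. exp (- (t * v)) *\<^sub>R apply_op (g t) x) \<longlongrightarrow> 0) at_top"
    by (rule low_tendsto) (use assms in \<open>simp add: g_def lead_def\<close>)
  moreover have "exp (- (t * v)) *\<^sub>R apply_op (g t) x = - apply_op A x" for t
    by (simp add: g_def assms(2) scaleR_minus_right scaleR_scaleC scaleC_minus_right scaleC_scaleC scaleC_one
        flip: of_real_mult exp_add)
  ultimately have "- apply_op A x = 0"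
    by (simp add: tendsto_const_iff)
  then show "apply_op A x = apply_op 0 x" by simp
qed

text \<open>Among the terms with nonzero coefficient the one of largest rate is unique by
  injectivity. All others are of lower growth, so its leading coefficient would have to
  vanish.\<close>

lemma lead_independent:
  fixes F :: "'i \<Rightarrow> real \<Rightarrow> 'd::complex_inner operator"
  assumes "finite J" "inj_on v J" and F: "\<And>j. j \<in> J \<Longrightarrow> F j \<in> lead (v j) (A j)"
    and A: "\<And>j. j \<in> J \<Longrightarrow> A j \<noteq> 0"
    and zero: "\<And>t. (\<Sum>j\<in>J. c j *\<^sub>C F j t) = 0"
  shows "\<forall>j\<in>J. c j = 0"
proof (rule ccontr)
  define K where "K = {j \<in> J. c j \<noteq> 0}"
  assume "\<not> ?thesis"
  then have K: "finite K" "K \<noteq> {}" "K \<subseteq> J"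
    using assms(1) by (auto simp: K_def)
  have "Max (v ` K) \<in> v ` K"
    using K by (intro Max_in) auto
  then obtain k where k: "k \<in> K" "v k = Max (v ` K)"
    by auto
  have less: "v j < v k" if "j \<in> K - {k}" for j
  proof -
    have "v j \<le> v k"
      using that K(1) by (simp add: k(2))
    moreover have "v j \<noteq> v k"
      using assms(2) that k(1) K(3) by (auto dest: inj_onD)
    ultimately show ?thesis by simp
  qed
  have "(\<lambda>t. \<Sum>j\<in>S. c j *\<^sub>C F j t) \<in> low (v k)" if "S \<subseteq> K - {k}" for S
  proof -
    have "finite S" using that K(1) finite_subset by blast
    then show ?thesis using that
    proof (induction S)
      case (insert j S)
      then have "j \<in> J" "j \<in> K - {k}" "S \<subseteq> K - {k}"
        using K(3) by auto
      from low_add[OF lead_low[OF lead_scale[OF F[OF this(1)]] less[OF this(2)]] insert.IH[OF this(3)]]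
      show ?case
        using insert.hyps by simp
    qed (simp add: low_zero)
  qed
  then have "(\<lambda>t. c k *\<^sub>C F k t + (\<Sum>j\<in>K - {k}. c j *\<^sub>C F j t)) \<in> lead (v k) (c k *\<^sub>C A k)"
    using k(1) K(3) by (intro lead_add_low lead_scale F) auto
  moreover have "c k *\<^sub>C F k t + (\<Sum>j\<in>K - {k}. c j *\<^sub>C F j t) = 0" for t
  proof -
    have "(\<Sum>j\<in>K. c j *\<^sub>C F j t) = (\<Sum>j\<in>J. c j *\<^sub>C F j t)"
      using assms(1) by (intro sum.mono_neutral_left) (auto simp: K_def)
    then show ?thesis
      using k(1) K(1) zero[of t] by (simp add: sum.remove[of K k])
  qed
  ultimately have "c k *\<^sub>C A k = 0"
    by (rule lead_eq_0)
  then show False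
    using A k(1) by (auto simp: K_def)
qed

text \<open>Real scalar translations preserve the commutators and Hermiticity of the
  \<open>Y1\<close>, \<open>Y2\<close>, \<open>Y3\<close>, and the given \<open>G1\<close>,
  \<open>G2\<close>, \<open>G3\<close> are replaced by positive scalars. The curve thus stays in
  \<open>quantum_shear\<close>, and identities of observables may be evaluated along it.\<close>

definition shear_curve :: "'d::complex_inner shear_data \<Rightarrow> (nat \<Rightarrow> real) \<Rightarrow> real \<Rightarrow> 'd shear_data" where
  "shear_curve d w t = \<lparr>Y1 = Y1 d + complex_of_real (t * w 1) *\<^sub>C 1, Y2 = Y2 d + complex_of_real (t * w 2) *\<^sub>C 1,
     Y3 = Y3 d + complex_of_real (t * w 3) *\<^sub>C 1, G1 = complex_of_real (exp (t * w 4)) *\<^sub>C 1,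
     G2 = complex_of_real (exp (t * w 5)) *\<^sub>C 1, G3 = complex_of_real (exp (t * w 6)) *\<^sub>C 1\<rparr>"

lemma shear_lin_curve:
  "shear_lin (shear_curve d w t) a0 a1 a2 a3 =
    shear_lin d (a0 + complex_of_real t * (a1 * w 1 + a2 * w 2 + a3 * w 3)) a1 a2 a3"
  by (simp add: shear_lin_def shear_curve_def cscale_add cscale_cscale add_cscale algebra_simps)

lemma hermitian_real: "hermitian (complex_of_real c *\<^sub>C 1)"
  using adjoint_op_scaleC[OF adjoint_op_one, of "complex_of_real c"] by (simp add: hermitian_iff_adjoint_op)

lemma hermitian_add: "hermitian A \<Longrightarrow> hermitian B \<Longrightarrow> hermitian (A + B)"
  unfolding hermitian_iff_adjoint_op by (rule adjoint_op_add)

context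
  fixes h :: real and d :: "'d::complex_inner shear_data"
  assumes d: "d \<in> quantum_shear h"
begin

lemma shear_curve_quantum_shear: "shear_curve d w t \<in> quantum_shear h"
proof -
  have comm: "(A + a *\<^sub>C 1) * (B + b *\<^sub>C 1) - (B + b *\<^sub>C 1) * (A + a *\<^sub>C 1) = A * B - B * A"
    for A B :: "'d operator" and a b
    by (simp add: algebra_simps cscale_mult_left cscale_mult_right cscale_cscale)
  have exps: "exp_summable (shear_lin (shear_curve d w t) a0 a1 a2 a3)" for a0 a1 a2 a3
    unfolding shear_lin_curve by (rule entire_op_exp_summable[OF entire_shear_lin[OF d]])
  have G: "c *\<^sub>C 1 * A = A * c *\<^sub>C 1" for A :: "'d operator" and c
    by (simp add: cscale_mult_left cscale_mult_right)
  have "hermitian (Y1 d)" "hermitian (Y2 d)" "hermitian (Y3 d)"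
    "Y1 d * Y2 d - Y2 d * Y1 d = (\<i> * pi * h) *\<^sub>C 1"
    "Y2 d * Y3 d - Y3 d * Y2 d = (\<i> * pi * h) *\<^sub>C 1"
    "Y3 d * Y1 d - Y1 d * Y3 d = (\<i> * pi * h) *\<^sub>C 1"
    using d unfolding quantum_shear_def by blast+
  then show ?thesis
    unfolding quantum_shear_def mem_Collect_eq
    using exps[unfolded shear_lin_def]
    by (simp only: shear_curve_def shear_data.select_convs comm G hermitian_add hermitian_real simp_thms ball_simps Ball_def insert_iff)
      (auto simp: G hermitian_real)
qed

lemma shear_exp_curve:
  "shear_exp (shear_curve d w t) a b c = complex_of_real (exp (t * (a * w 1 + b * w 2 + c * w 3))) *\<^sub>C shear_exp d a b c"
  unfolding shear_exp_def shear_lin_curve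
  by (subst op_exp_shear_lin_const[OF d]) (simp add: exp_of_real[symmetric])

lemma lead_shear_exp:
  "(\<lambda>t. shear_exp (shear_curve d w t) a b c) \<in> lead (a * w 1 + b * w 2 + c * w 3) (shear_exp d a b c)"
  unfolding shear_exp_curve by (rule lead_exp)

lemma low_shear_exp:
  "a * w 1 + b * w 2 + c * w 3 < v \<Longrightarrow> (\<lambda>t. shear_exp (shear_curve d w t) a b c) \<in> low v"
  by (rule lead_low[OF lead_shear_exp])

lemma lead_G:
  "(\<lambda>t. G1 (shear_curve d w t)) \<in> lead (w 4) 1"
  "(\<lambda>t. G2 (shear_curve d w t)) \<in> lead (w 5) 1"
  "(\<lambda>t. G3 (shear_curve d w t)) \<in> lead (w 6) 1"
  unfolding shear_curve_def shear_data.select_convs by (rule lead_exp)+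

lemma low_G_shear_exp:
  "w 4 + (a * w 1 + b * w 2 + c * w 3) < v \<Longrightarrow> (\<lambda>t. G1 (shear_curve d w t) * shear_exp (shear_curve d w t) a b c) \<in> low v"
  "w 5 + (a * w 1 + b * w 2 + c * w 3) < v \<Longrightarrow> (\<lambda>t. G2 (shear_curve d w t) * shear_exp (shear_curve d w t) a b c) \<in> low v"
  "w 6 + (a * w 1 + b * w 2 + c * w 3) < v \<Longrightarrow> (\<lambda>t. G3 (shear_curve d w t) * shear_exp (shear_curve d w t) a b c) \<in> low v"
  by (rule lead_low[OF lead_mult[OF lead_G(1) lead_shear_exp]] lead_low[OF lead_mult[OF lead_G(2) lead_shear_exp]]
      lead_low[OF lead_mult[OF lead_G(3) lead_shear_exp]]; assumption)+

text \<open>Positive rates let the all-positive exponential beat the others of its kind. As every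
  \<open>Y\<close> rate exceeds every \<open>G\<close> rate, exchanging an exponential factor for
  some \<open>G1\<close>, \<open>G2\<close> or \<open>G3\<close> loses growth.\<close>

lemma lead_geodesics:
  assumes w: "\<And>i j. i \<in> {1, 2, 3} \<Longrightarrow> j \<in> {4, 5, 6} \<Longrightarrow> 0 < w j \<and> w j < w i"
  shows "(\<lambda>t. G12 (shear_curve d w t)) \<in> lead (w 1 + w 2) (shear_exp d 1 1 0)"
    "(\<lambda>t. G23 (shear_curve d w t)) \<in> lead (w 2 + w 3) (shear_exp d 0 1 1)"
    "(\<lambda>t. G13 (shear_curve d w t)) \<in> lead (w 1 + w 3) (shear_exp d 1 0 1)"
    "(\<lambda>t. Ginf (shear_curve d w t)) \<in> lead (w 1 + w 2 + w 3) (shear_exp d 1 1 1)"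
proof -
  have less: "w 4 < w 1" "w 4 < w 2" "w 4 < w 3"
    "w 5 < w 1" "w 5 < w 2" "w 5 < w 3" "w 6 < w 1" "w 6 < w 2" "w 6 < w 3"
    by (simp_all only: w insert_iff simp_thms)
  moreover have "0 < w 4"
    using w[OF insertI1 insertI1] by (rule conjunct1)
  ultimately have pos: "0 < w 1" "0 < w 2" "0 < w 3"
    by linarith+
  note rules = lead_add_low low_shear_exp low_G_shear_exp
  note L = lead_shear_exp[of w]
  show "(\<lambda>t. G12 (shear_curve d w t)) \<in> lead (w 1 + w 2) (shear_exp d 1 1 0)"
    unfolding geodesic_shear_exp[OF shear_curve_quantum_shear]
    using L[of 1 1 0] pos less by (intro rules) simp_all
  show "(\<lambda>t. G23 (shear_curve d w t)) \<in> lead (w 2 + w 3) (shear_exp d 0 1 1)"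
    unfolding geodesic_shear_exp[OF shear_curve_quantum_shear]
    using L[of 0 1 1] pos less by (intro rules) simp_all
  show "(\<lambda>t. G13 (shear_curve d w t)) \<in> lead (w 1 + w 3) (shear_exp d 1 0 1)"
    unfolding geodesic_shear_exp[OF shear_curve_quantum_shear]
    using L[of 1 0 1] pos less by (intro rules) simp_all
  show "(\<lambda>t. Ginf (shear_curve d w t)) \<in> lead (w 1 + w 2 + w 3) (shear_exp d 1 1 1)"
    unfolding geodesic_shear_exp[OF shear_curve_quantum_shear]
    using L[of 1 1 1] pos less by (intro rules) simp_all
qed

end

lemma digits_unique:
  fixes i :: nat
  assumes "i < B" "i' < B" "i + B * s = i' + B * s'"
  shows "i = i' \<and> s = s'"
proof -
  have "i = (i + B * s) mod B" "s = (i + B * s) div B"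
    using assms(1) by simp_all
  moreover have "i' = (i' + B * s') mod B" "s' = (i' + B * s') div B"
    using assms(2) by simp_all
  ultimately show ?thesis
    using assms(3) by metis
qed

section \<open>Independence of ordered monomials\<close>

type_synonym exponents = "nat \<times> nat \<times> nat \<times> nat \<times> nat \<times> nat \<times> nat"

fun pbw_monomial :: "'a::monoid_mult \<Rightarrow> 'a \<Rightarrow> 'a \<Rightarrow> 'a \<Rightarrow> 'a \<Rightarrow> 'a \<Rightarrow> 'a \<Rightarrow> 'a \<Rightarrow> exponents \<Rightarrow> 'a" where
  "pbw_monomial u X Y Z g1 g2 g3 e (a, b, c, l, i, j, k) =
    X ^ a * (Y ^ b * (Z ^ c * (e ^ l * (g1 ^ i * (g2 ^ j * (g3 ^ k * u))))))"

text \<open>Growth rate along the curve with \<open>w = (B\<^sup>3, B\<^sup>4, B\<^sup>5, 1, B, B\<^sup>2)\<close>, so that its digits in base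
  \<open>B\<close> determine the monomial.\<close>
fun pbw_weight :: "nat \<Rightarrow> exponents \<Rightarrow> nat" where
  "pbw_weight B (a, b, c, l, i, j, k) =
    i + B * (j + B * (k + B * ((a + c + l) + B * ((a + b + l) + B * (b + c + l)))))"

definition pbw_exponents :: "nat \<Rightarrow> exponents set" where
  "pbw_exponents B = {(a, b, c, l, i, j, k). l \<le> 1 \<and> a + b + c + l < B \<and> i < B \<and> j < B \<and> k < B}"

text \<open>The digits return \<open>i\<close>, \<open>j\<close>, \<open>k\<close> and three sums
  whose total is \<open>3 * l + 2 * (a + b + c)\<close>. Its parity determines \<open>l\<close>
  because \<open>l \<le> 1\<close>, and then the sums determine the rest. Without the bound on
  \<open>l\<close>, the square of \<open>e\<close> would collide with the product of
  \<open>X\<close>, \<open>Y\<close>, \<open>Z\<close>.\<close>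

lemma inj_on_pbw_weight: "inj_on (pbw_weight B) (pbw_exponents B)"
proof (rule inj_onI)
  fix x y
  assume x: "x \<in> pbw_exponents B" and y: "y \<in> pbw_exponents B" and eq: "pbw_weight B x = pbw_weight B y"
  obtain a b c l i j k where x': "x = (a, b, c, l, i, j, k)" by (rule prod_cases7)
  obtain a' b' c' l' i' j' k' where y': "y = (a', b', c', l', i', j', k')" by (rule prod_cases7)
  have bounds: "i < B" "j < B" "k < B" "a + c + l < B" "a + b + l < B" "l \<le> 1"
    "i' < B" "j' < B" "k' < B" "a' + c' + l' < B" "a' + b' + l' < B" "l' \<le> 1"
    using x y unfolding x' y' pbw_exponents_def by auto
  note eq1 = digits_unique[OF bounds(1) bounds(7) eq[unfolded x' y' pbw_weight.simps]]
  note eq2 = digits_unique[OF bounds(2) bounds(8) eq1[THEN conjunct2]]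
  note eq3 = digits_unique[OF bounds(3) bounds(9) eq2[THEN conjunct2]]
  note eq4 = digits_unique[OF bounds(4) bounds(10) eq3[THEN conjunct2]]
  note eq5 = digits_unique[OF bounds(5) bounds(11) eq4[THEN conjunct2]]
  have s: "a + c + l = a' + c' + l'" "a + b + l = a' + b' + l'" "b + c + l = b' + c' + l'"
    using eq4 eq5 by auto
  have "3 * l + 2 * (a + b + c) = (a + c + l) + (a + b + l) + (b + c + l)"
    by simp
  also have "\<dots> = 3 * l' + 2 * (a' + b' + c')"
    unfolding s by simp
  finally have "3 * l + 2 * (a + b + c) = 3 * l' + 2 * (a' + b' + c')" .
  then have "even l \<longleftrightarrow> even l'"
    by (metis even_add even_mult_iff even_numeral odd_numeral)
  moreover have "l = 0 \<or> l = 1" "l' = 0 \<or> l' = 1"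
    using bounds(6,12) by linarith+
  ultimately have "l = l'"
    by auto
  then have "a = a'" "b = b'" "c = c'"
    using s by linarith+
  then show "x = y"
    using \<open>l = l'\<close> eq1 eq2 eq3 by (simp add: x' y')
qed

lemma finite_subset_pbw_exponents:
  assumes "finite J" and "\<And>a b c l i j k. (a, b, c, l, i, j, k) \<in> J \<Longrightarrow> l \<le> 1"
  obtains B where "B \<ge> 2" "J \<subseteq> pbw_exponents B"
proof -
  define size where "size = (\<lambda>(a, b, c, l, i, j, k). a + b + c + l + i + j + k :: nat)"
  define B where "B = 2 + (\<Sum>x\<in>J. size x)"
  have "J \<subseteq> pbw_exponents B"
  proof
    fix x assume x: "x \<in> J"
    obtain a b c l i j k where x': "x = (a, b, c, l, i, j, k)" by (rule prod_cases7)
    have "size x < B"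
      using sum_nonneg_leq_bound[of J size "\<Sum>x\<in>J. size x" x] assms(1) x by (simp add: B_def)
    then show "x \<in> pbw_exponents B"
      using assms(2) x unfolding x' pbw_exponents_def size_def by auto
  qed
  then show ?thesis
    using that[of B] by (simp add: B_def)
qed

lemma power_left_inverse: "B * A = (1 :: 'a::monoid_mult) \<Longrightarrow> B ^ n * A ^ n = 1"
proof (induction n)
  case (Suc n)
  have "B ^ Suc n * A ^ Suc n = B ^ n * (B * (A * A ^ n))"
    by (simp only: power_Suc2[of B] power_Suc[of A] mult.assoc)
  also have "\<dots> = B ^ n * A ^ n"
    using Suc.prems by (simp flip: mult.assoc)
  finally show ?case
    using Suc by simp
qed simp

lemma mult_left_cancel_rule: "B * A = (1 :: 'a::monoid_mult) \<Longrightarrow> B * (A * t) = t"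
  by (simp flip: mult.assoc)

text \<open>Each monomial's leading coefficient is a product of invertible exponentials, nonzero on
  a nonzero space, and the weights make the rates distinct. Vanishing is assumed at all shear data
  because it is used along a whole curve.\<close>

lemma pbw_independent:
  fixes d :: "'d::complex_inner shear_data"
  assumes d: "d \<in> quantum_shear h" and one: "(1 :: 'd operator) \<noteq> 0"
    and "finite J" and l: "\<And>a b c l i j k. (a, b, c, l, i, j, k) \<in> J \<Longrightarrow> l \<le> 1"
    and zero: "\<And>d :: 'd shear_data. d \<in> quantum_shear h \<Longrightarrow>
      (\<Sum>x\<in>J. s x *\<^sub>C pbw_monomial 1 (G12 d) (G23 d) (G13 d) (G1 d) (G2 d) (G3 d) (Ginf d) x) = 0"
  shows "\<forall>x\<in>J. s x = 0"
proof -
  obtain B where B: "B \<ge> 2" "J \<subseteq> pbw_exponents B"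
    by (rule finite_subset_pbw_exponents[OF assms(3)]) (erule l, blast)
  define w where "w = (\<lambda>n :: nat. real (if n = 1 then B ^ 3 else if n = 2 then B ^ 4 else if n = 3 then B ^ 5
    else if n = 4 then 1 else if n = 5 then B else B ^ (2::nat)))"
  have w: "0 < w j \<and> w j < w i" if "i \<in> {1, 2, 3}" "j \<in> {4, 5, 6}" for i j :: nat
  proof -
    have p: "B ^ m < B ^ n" if "m < n" for m n :: nat
      using B(1) that by (intro power_strict_increasing) auto
    show ?thesis
      using that p[of 0 3] p[of 0 4] p[of 0 5] p[of 1 3] p[of 1 4] p[of 1 5] p[of 2 3] p[of 2 4] p[of 2 5] B(1)
      unfolding w_def by (auto simp del: of_nat_power simp flip: One_nat_def)
  qed
  let ?E = "shear_exp d"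
  define A where "A = pbw_monomial (1 :: 'd operator) (?E 1 1 0) (?E 0 1 1) (?E 1 0 1) 1 1 1 (?E 1 1 1)"
  define F where "F = (\<lambda>x t. let d = shear_curve d w t in
    pbw_monomial 1 (G12 d) (G23 d) (G13 d) (G1 d) (G2 d) (G3 d) (Ginf d) x)"
  show ?thesis
  proof (rule lead_independent[where F = F and v = "\<lambda>x. real (pbw_weight B x)" and A = A])
    show "inj_on (\<lambda>x. real (pbw_weight B x)) J"
      using inj_on_subset[OF inj_on_pbw_weight B(2)] by (simp add: inj_on_def)
    show "F x \<in> lead (real (pbw_weight B x)) (A x)" for x
    proof -
      obtain a b c l i j k where x: "x = (a, b, c, l, i, j, k)" by (rule prod_cases7)
      note G = lead_geodesics[OF d w]
      note L = lead_mult[OF lead_power[OF G(1)] lead_mult[OF lead_power[OF G(2)] lead_mult[OF lead_power[OF G(3)]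
        lead_mult[OF lead_power[OF G(4)] lead_mult[OF lead_power[OF lead_G(1)[OF d]] lead_mult[OF lead_power[OF lead_G(2)[OF d]]
        lead_mult[OF lead_power[OF lead_G(3)[OF d]] lead_one]]]]]]]
      have "F x \<in> lead (real a * (w 1 + w 2) + (real b * (w 2 + w 3) + (real c * (w 1 + w 3) + (real l * (w 1 + w 2 + w 3)
          + (real i * w 4 + (real j * w 5 + (real k * w 6 + 0))))))) (A x)"
        unfolding F_def A_def x Let_def pbw_monomial.simps by (rule L)
      moreover have "real a * (w 1 + w 2) + (real b * (w 2 + w 3) + (real c * (w 1 + w 3) + (real l * (w 1 + w 2 + w 3)
          + (real i * w 4 + (real j * w 5 + (real k * w 6 + 0)))))) = real (pbw_weight B x)"
        unfolding x w_def by (simp add: algebra_simps power_numeral_reduce)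
      ultimately show ?thesis
        by simp
    qed
    show "A x \<noteq> 0" for x
    proof -
      obtain a b c l i j k where x: "x = (a, b, c, l, i, j, k)" by (rule prod_cases7)
      have inv: "?E (- m1) (- m2) (- m3) * ?E m1 m2 m3 = 1" for m1 m2 m3
        by (simp add: shear_exp_mult[OF d] shear_exp_0[OF d] cscale_one)
      note pinv = power_left_inverse[OF inv]
      \<comment> \<open>The inverse powers, in reverse order, strip the factors one by one. The form
        \<open>-0\<close> lets the entries match the pattern of \<open>inv\<close>.\<close>
      have "?E (-1) (-1) (-1) ^ l * (?E (-1) (-0) (-1) ^ c * (?E (-0) (-1) (-1) ^ b * (?E (-1) (-1) (-0) ^ a * A x))) = 1"
        unfolding A_def x pbw_monomial.simps
        by (simp only: mult_1_right power_one pinv pinv[THEN mult_left_cancel_rule])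
      then show ?thesis
        using one by auto
    qed
    show "(\<Sum>x\<in>J. s x *\<^sub>C F x t) = 0" for t
      using zero[OF shear_curve_quantum_shear[OF d]] by (simp add: F_def Let_def)
  qed (rule assms(3))
qed

section \<open>The algebra of observables\<close>

lemma obs_in [simp]: "d \<in> quantum_shear h \<Longrightarrow> obs h F d = F d"
  by (simp add: obs_def)

lemma obs_out: "d \<notin> quantum_shear h \<Longrightarrow> obs h F d = 0"
  by (simp add: obs_def)

lemma obs_omega:
  "obs h omega12 = obs h G1 * obs h G2 + obs h G3 * obs h Ginf"
  "obs h omega23 = obs h G2 * obs h G3 + obs h G1 * obs h Ginf"
  "obs h omega13 = obs h G1 * obs h G3 + obs h G2 * obs h Ginf"
  by (auto simp: fun_eq_iff obs_def omega12_def omega23_def omega13_def)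

text \<open>The axioms are equations in the algebra, together with one on scalars, and so can be
  tested pointwise. The index is a shear datum for observables and a truth value for pairs.\<close>

lemma four_holed_algebra_fun:
  assumes "\<And>d. four_holed_algebra p r (u d) (X d) (Y d) (Z d) (g1 d) (g2 d) (g3 d) (e d)"
  shows "four_holed_algebra p r u X Y Z g1 g2 g3 e"
  using assms unfolding four_holed_algebra_def
  by (simp only: fun_eq_iff times_fun_apply plus_fun_apply minus_apply scaleC_fun_apply all_simps) blast

lemma four_holed_algebra_obs:
  "four_holed_algebra (q_pow h (1/2)) (q_pow h (- 1/2)) (obs h 1 :: 'd::complex_inner shear_data \<Rightarrow> 'd operator)
    (obs h G12) (obs h G23) (obs h G13) (obs h G1) (obs h G2) (obs h G3) (obs h Ginf)"
proof -
  have sq: "q_pow h (- 1/2) * q_pow h (- 1/2) = q_pow h (- 1)" "q_pow h (1/2) * q_pow h (1/2) = q_pow h 1"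
    by (simp_all add: q_pow_add)
  have *: "four_holed_algebra (q_pow h (1/2)) (q_pow h (- 1/2)) 1 (G12 d) (G23 d) (G13 d) (G1 d) (G2 d) (G3 d) (Ginf d)"
    if d: "d \<in> quantum_shear h" for d :: "'d shear_data"
  proof
    show "q_pow h (1/2) * q_pow h (- 1/2) = 1"
      by (simp add: q_pow_add)
    show "q_pow h (- 1/2) *\<^sub>C (G12 d * (G23 d * G13 d)) - (q_pow h (- 1/2) * q_pow h (- 1/2)) *\<^sub>C (G12 d * G12 d)
       - (q_pow h (1/2) * q_pow h (1/2)) *\<^sub>C (G23 d * G23 d) - (q_pow h (- 1/2) * q_pow h (- 1/2)) *\<^sub>C (G13 d * G13 d)
       - q_pow h (- 1/2) *\<^sub>C ((G1 d * G2 d + G3 d * Ginf d) * G12 d)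
       - q_pow h (1/2) *\<^sub>C ((G2 d * G3 d + G1 d * Ginf d) * G23 d)
       - q_pow h (- 1/2) *\<^sub>C ((G1 d * G3 d + G2 d * Ginf d) * G13 d)
     = G1 d * G1 d + G2 d * G2 d + G3 d * G3 d + Ginf d * Ginf d + G1 d * (G2 d * (G3 d * Ginf d))
       - (q_pow h (1/2) * q_pow h (1/2) + q_pow h (- 1/2) * q_pow h (- 1/2) + 2) *\<^sub>C 1"
      using casimir_eq[OF d] unfolding casimir_def sq omega12_def omega23_def omega13_def power2_eq_square mult.assoc .
  qed (use commutation_G12_G23[OF d] commutation_G23_G13[OF d] commutation_G13_G12[OF d] central_geodesics[OF d]
      geodesics_commute_Ginf[OF d] central_Ginf[OF d] central_left_commute(7,9,11)[OF d]
      in \<open>simp_all only: sq omega12_def omega23_def omega13_def mult_1_left mult_1_right insert_iff simp_thms\<close>)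
  \<comment> \<open>Outside \<open>quantum_shear\<close> every generator and the unit vanish, and
    the zero tuple satisfies the axioms.\<close>
  have zero: "four_holed_algebra (q_pow h (1/2)) (q_pow h (- 1/2)) (0 :: 'd operator) 0 0 0 0 0 0 0"
    by unfold_locales (simp_all add: q_pow_add)
  show ?thesis
  proof (rule four_holed_algebra_fun)
    fix d :: "'d shear_data"
    show "four_holed_algebra (q_pow h (1/2)) (q_pow h (- 1/2)) (obs h 1 d) (obs h G12 d) (obs h G23 d) (obs h G13 d)
      (obs h G1 d) (obs h G2 d) (obs h G3 d) (obs h Ginf d)"
      using *[of d] zero by (cases "d \<in> quantum_shear h") (simp_all add: obs_out)
  qed
qed

text \<open>Functions on \<^typ>\<open>bool\<close> rather than a product type, in order to inherit the algebra structure.\<close>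
definition pair :: "'a \<Rightarrow> 'a \<Rightarrow> bool \<Rightarrow> 'a" where
  "pair x y = (\<lambda>b. if b then x else y)"

lemma pair_simps:
  "pair x y True = x" "pair x y False = y"
  "pair x y + pair x' y' = pair (x + x') (y + y')"
  "pair x y - pair x' y' = pair (x - x') (y - y')"
  "pair x y * pair x' y' = pair (x * x') (y * y')"
  "c *\<^sub>C pair x y = pair (c *\<^sub>C x) (c *\<^sub>C y)"
  for x y x' y' :: "'a::complex_algebra"
  by (auto simp: pair_def fun_eq_iff)

lemma four_holed_algebra_pair:
  assumes "four_holed_algebra p r u X Y Z g1 g2 g3 e" "four_holed_algebra p r u' X' Y' Z' g1' g2' g3' e'"
  shows "four_holed_algebra p r (pair u u') (pair X X') (pair Y Y') (pair Z Z')
    (pair g1 g1') (pair g2 g2') (pair g3 g3') (pair e e')"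
proof (rule four_holed_algebra_fun)
  fix b
  show "four_holed_algebra p r (pair u u' b) (pair X X' b) (pair Y Y' b) (pair Z Z' b)
    (pair g1 g1' b) (pair g2 g2' b) (pair g3 g3' b) (pair e e' b)"
    using assms by (cases b) (simp_all add: pair_simps)
qed

lemma pbw_monomial_apply:
  "pbw_monomial u X Y Z g1 g2 g3 e x b = pbw_monomial (u b) (X b) (Y b) (Z b) (g1 b) (g2 b) (g3 b) (e b) x"
  by (induction x rule: pbw_weight.induct[of _ 0]) (simp add: fun_power_apply)

text \<open>Spans supply coefficients indexed by elements, while independence speaks of exponents,
  and different exponents may give equal elements. One exponent tuple is chosen for each element
  that occurs.\<close>

lemma (in four_holed_algebra) filt_explicit:
  assumes "x \<in> filt n"
  obtains J s where "finite J" "\<And>a b c l i j k. (a, b, c, l, i, j, k) \<in> J \<Longrightarrow> l \<le> 1"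
    "x = (\<Sum>y\<in>J. s y *\<^sub>C pbw_monomial u X Y Z g1 g2 g3 e y)"
proof -
  let ?M = "pbw_monomial u X Y Z g1 g2 g3 e"
  define I :: "exponents set" where "I = {(a, b, c, l, i, j, k). l \<le> 1}"
  have sub: "normal_forms n \<subseteq> ?M ` I"
  proof
    fix x assume "x \<in> normal_forms n"
    then obtain a b c l i j k where "x = pbw a b c l (g1 ^ i * (g2 ^ j * (g3 ^ k * u)))" "l \<le> 1"
      unfolding normal_forms_def centrals_def by blast
    then show "x \<in> ?M ` I"
      by (intro image_eqI[where x = "(a, b, c, l, i, j, k)"]) (simp_all add: pbw_def I_def)
  qed
  obtain t s where t: "finite t" "t \<subseteq> normal_forms n" "x = (\<Sum>y\<in>t. s y *\<^sub>C y)"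
    using assms unfolding filt_def cvs.span_explicit by blast
  then have "t \<subseteq> ?M ` I"
    using subset_trans[OF t(2) sub] by simp
  then obtain J where J: "J \<subseteq> I" "inj_on ?M J" "t = ?M ` J"
    unfolding subset_image_inj by blast
  have "finite J"
    using t(1) J(2,3) by (simp add: finite_image_iff)
  show ?thesis
  proof (rule that[of J "\<lambda>y. s (?M y)"])
    show "x = (\<Sum>y\<in>J. s (?M y) *\<^sub>C ?M y)"
      unfolding t(3) J(3) by (rule sum.reindex_cong[OF J(2) refl refl])
  qed (use J(1) \<open>finite J\<close> in \<open>auto simp: I_def\<close>)
qed

section \<open>Homomorphisms defined by the presentation\<close>

abbreviation geodesic_generators :: "real \<Rightarrow> ('d::complex_inner shear_data \<Rightarrow> 'd operator) set" where
  "geodesic_generators h \<equiv> {obs h G12, obs h G23, obs h G13, obs h G1, obs h G2, obs h G3, obs h Ginf}"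

lemma geodesic_algebra_eq: "geodesic_algebra h = generated_algebra (obs h 1) (geodesic_generators h)"
  by (simp add: geodesic_algebra_def)

text \<open>Both components of a graph element reduce with the same coefficients. Independence in
  the first component forces these to be zero, and so the second component vanishes as well.\<close>

lemma pair_generated_zero:
  fixes d :: "'d::complex_inner shear_data"
  assumes d: "d \<in> quantum_shear h"
    and alg: "four_holed_algebra (q_pow h (1/2)) (q_pow h (- 1/2)) (obs h 1 :: 'd shear_data \<Rightarrow> 'd operator) X Y Z g1 g2 g3 e"
    and z: "pair 0 z \<in> generated_algebra (pair (obs h 1) (obs h 1)) {pair (obs h G12) X, pair (obs h G23) Y,
      pair (obs h G13) Z, pair (obs h G1) g1, pair (obs h G2) g2, pair (obs h G3) g3, pair (obs h Ginf) e}"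
  shows "z = 0"
proof (cases "(1 :: 'd operator) = 0")
  case True
  have "A = 0" for A :: "'d operator"
    using True by (metis mult_1 mult_zero_left)
  then show ?thesis
    by (intro ext) simp
next
  case False
  interpret P: four_holed_algebra "q_pow h (1/2)" "q_pow h (- 1/2)" "pair (obs h 1) (obs h 1)" "pair (obs h G12) X"
    "pair (obs h G23) Y" "pair (obs h G13) Z" "pair (obs h G1) g1" "pair (obs h G2) g2" "pair (obs h G3) g3" "pair (obs h Ginf) e"
    by (rule four_holed_algebra_pair[OF four_holed_algebra_obs alg])
  let ?M = "pbw_monomial (pair (obs h 1) (obs h 1)) (pair (obs h G12) X) (pair (obs h G23) Y)
    (pair (obs h G13) Z) (pair (obs h G1) g1) (pair (obs h G2) g2) (pair (obs h G3) g3) (pair (obs h Ginf) e)"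
  obtain n where "pair 0 z \<in> P.filt n"
    using P.generated_algebra_filt[OF z] by blast
  then obtain J s where J: "finite J" "\<And>a b c l i j k. (a, b, c, l, i, j, k) \<in> J \<Longrightarrow> l \<le> 1"
    "pair 0 z = (\<Sum>y\<in>J. s y *\<^sub>C ?M y)"
    by (rule P.filt_explicit) blast
  have "(\<Sum>x\<in>J. s x *\<^sub>C pbw_monomial 1 (G12 d) (G23 d) (G13 d) (G1 d) (G2 d) (G3 d) (Ginf d) x) = 0"
    if d: "d \<in> quantum_shear h" for d :: "'d shear_data"
  proof -
    have "(\<Sum>y\<in>J. s y *\<^sub>C ?M y) True d = 0"
      unfolding J(3)[symmetric] by (simp add: pair_simps)
    then show ?thesis
      using d by (simp add: fun_sum_apply pbw_monomial_apply pair_simps)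
  qed
  then have "\<forall>x\<in>J. s x = 0"
    using J(2) by (intro pbw_independent[OF d False J(1)]) blast+
  then have "pair 0 z = 0"
    unfolding J(3) by simp
  from fun_cong[OF this, of False] show ?thesis
    by (simp add: pair_simps)
qed

text \<open>Bijectivity is postponed: it follows only from the relations between both braid
  generators.\<close>

definition algebra_endomorphism :: "'a \<Rightarrow> 'a::{plus, times, scaleC} set \<Rightarrow> ('a \<Rightarrow> 'a) \<Rightarrow> bool" where
  "algebra_endomorphism u A \<beta> \<longleftrightarrow> \<beta> u = u \<and> (\<forall>x\<in>A. \<beta> x \<in> A) \<and>
    (\<forall>x\<in>A. \<forall>y\<in>A. \<beta> (x + y) = \<beta> x + \<beta> y \<and> \<beta> (x * y) = \<beta> x * \<beta> y) \<and>
    (\<forall>x\<in>A. \<forall>c. \<beta> (c *\<^sub>C x) = c *\<^sub>C \<beta> x)"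

lemma algebra_endomorphismD:
  assumes "algebra_endomorphism u A \<beta>"
  shows "\<beta> u = u" "x \<in> A \<Longrightarrow> \<beta> x \<in> A" "x \<in> A \<Longrightarrow> y \<in> A \<Longrightarrow> \<beta> (x + y) = \<beta> x + \<beta> y"
    "x \<in> A \<Longrightarrow> y \<in> A \<Longrightarrow> \<beta> (x * y) = \<beta> x * \<beta> y" "x \<in> A \<Longrightarrow> \<beta> (c *\<^sub>C x) = c *\<^sub>C \<beta> x"
  using assms unfolding algebra_endomorphism_def by blast+

text \<open>The universal property of the presentation, obtained without forming a quotient: the
  generated set of pairs is shown to be the graph of a function.\<close>

lemma geodesic_algebra_hom_exists:
  fixes d :: "'d::complex_inner shear_data" and X :: "'d shear_data \<Rightarrow> 'd operator"
  assumes d: "d \<in> quantum_shear h"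
    and alg: "four_holed_algebra (q_pow h (1/2)) (q_pow h (- 1/2)) (obs h 1) X Y Z g1 g2 g3 e"
    and closed: "X \<in> geodesic_algebra h" "Y \<in> geodesic_algebra h" "Z \<in> geodesic_algebra h"
      "g1 \<in> geodesic_algebra h" "g2 \<in> geodesic_algebra h" "g3 \<in> geodesic_algebra h" "e \<in> geodesic_algebra h"
  obtains \<beta> :: "('d shear_data \<Rightarrow> 'd operator) \<Rightarrow> ('d shear_data \<Rightarrow> 'd operator)" where "algebra_endomorphism (obs h 1) (geodesic_algebra h) \<beta>" "\<beta> (obs h G12) = X" "\<beta> (obs h G23) = Y" "\<beta> (obs h G13) = Z"
    "\<beta> (obs h G1) = g1" "\<beta> (obs h G2) = g2" "\<beta> (obs h G3) = g3" "\<beta> (obs h Ginf) = e"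
proof -
  let ?A = "geodesic_algebra h"
  define R where "R = generated_algebra (pair (obs h 1) (obs h 1)) {pair (obs h G12) X, pair (obs h G23) Y,
      pair (obs h G13) Z, pair (obs h G1) g1, pair (obs h G2) g2, pair (obs h G3) g3, pair (obs h Ginf) e}"
  define \<beta> where "\<beta> = (\<lambda>x. THE y. pair x y \<in> R)"
  have gens: "pair (obs h 1) (obs h 1) \<in> R" "pair (obs h G12) X \<in> R" "pair (obs h G23) Y \<in> R" "pair (obs h G13) Z \<in> R"
    "pair (obs h G1) g1 \<in> R" "pair (obs h G2) g2 \<in> R" "pair (obs h G3) g3 \<in> R" "pair (obs h Ginf) e \<in> R"
    unfolding R_def by (rule generated_algebra.unit, (rule generated_algebra.generator, blast)+)
  have add: "pair (x + x') (y + y') \<in> R" if "pair x y \<in> R" "pair x' y' \<in> R" for x y x' y'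
    using generated_algebra.add[OF that[unfolded R_def]] by (simp only: R_def pair_simps)
  have mult: "pair (x * x') (y * y') \<in> R" if "pair x y \<in> R" "pair x' y' \<in> R" for x y x' y'
    using generated_algebra.mult[OF that[unfolded R_def]] by (simp only: R_def pair_simps)
  have scale: "pair (c *\<^sub>C x) (c *\<^sub>C y) \<in> R" if "pair x y \<in> R" for x y c
    using generated_algebra.scale[OF that[unfolded R_def], of c] by (simp only: R_def pair_simps)
  have unique: "y = y'" if "pair x y \<in> R" "pair x y' \<in> R" for x y y'
  proof -
    \<comment> \<open>Differences are written as addition of the multiple by -1, the operations
      under which the graph is closed.\<close>
    have "pair (x + (-1) *\<^sub>C x) (y + (-1) *\<^sub>C y') \<in> R"
      by (rule add[OF that(1) scale[OF that(2)]])
    then have "pair 0 (y - y') \<in> R"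
      by (simp add: cscale_minus_left cscale_one)
    from pair_generated_zero[OF d alg this[unfolded R_def]] show ?thesis by simp
  qed
  have eq: "\<beta> x = y" if "pair x y \<in> R" for x y
    unfolding \<beta>_def by (rule the_equality, rule that, rule unique[OF _ that])
  have "\<exists>y\<in>?A. pair x y \<in> R" if "x \<in> ?A" for x
    using that unfolding geodesic_algebra_eq[of h]
  proof (induction rule: generated_algebra.induct)
    case unit
    then show ?case using gens(1) generated_algebra.unit by blast
  next
    case (generator x)
    then show ?case using gens(2-) closed unfolding geodesic_algebra_eq by blast
  next
    case (add x y)
    then show ?case using \<open>\<And>x y x' y'. pair x y \<in> R \<Longrightarrow> pair x' y' \<in> R \<Longrightarrow> pair (x + x') (y + y') \<in> R\<close>
      by (meson generated_algebra.add)
  next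
    case (mult x y)
    then show ?case using \<open>\<And>x y x' y'. pair x y \<in> R \<Longrightarrow> pair x' y' \<in> R \<Longrightarrow> pair (x * x') (y * y') \<in> R\<close>
      by (meson generated_algebra.mult)
  next
    case (scale x c)
    then show ?case using \<open>\<And>x y c. pair x y \<in> R \<Longrightarrow> pair (c *\<^sub>C x) (c *\<^sub>C y) \<in> R\<close>
      by (meson generated_algebra.scale)
  qed
  then have total: "pair x (\<beta> x) \<in> R" "\<beta> x \<in> ?A" if "x \<in> ?A" for x
    using that eq by metis+
  show ?thesis
    by (rule that[of \<beta>]) (auto simp: algebra_endomorphism_def intro: eq gens total add mult scale)
qed

section \<open>The quantum braid group\<close>

lemma op_exp_shear_coordinates:
  fixes d :: "'d::complex_inner shear_data"
  assumes d: "d \<in> quantum_shear h" and "A \<in> {Y1 d, Y2 d, Y3 d}" "B \<in> {Y1 d, Y2 d, Y3 d}"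
  shows "op_exp (a *\<^sub>C A) * op_exp (b *\<^sub>C B) = op_exp (a *\<^sub>C A + b *\<^sub>C B + (a * b / 2) *\<^sub>C (A * B - B * A))"
proof -
  have lin: "\<exists>a1 a2 a3. C = shear_lin d 0 a1 a2 a3" if "C \<in> {Y1 d, Y2 d, Y3 d}" for C
  proof -
    have "Y1 d = shear_lin d 0 1 0 0" "Y2 d = shear_lin d 0 0 1 0" "Y3 d = shear_lin d 0 0 0 1"
      by (simp_all add: shear_lin_def cscale_one)
    then show ?thesis
      using that by blast
  qed
  obtain a1 a2 a3 where A: "A = shear_lin d 0 a1 a2 a3"
    using lin[OF assms(2)] by blast
  obtain b1 b2 b3 where B: "B = shear_lin d 0 b1 b2 b3"
    using lin[OF assms(3)] by blast
  have scalar: "c *\<^sub>C 1 = shear_lin d c 0 0 0" for c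
    by (simp add: shear_lin_def)
  show ?thesis
    unfolding A B shear_lin_commutator[OF d]
    unfolding shear_lin_scaleC cscale_cscale scalar shear_lin_add op_exp_shear_lin[OF d]
    by (simp add: algebra_simps add_divide_distrib diff_divide_distrib)
qed

lemma weyl_ordering:
  assumes d: "d \<in> quantum_shear h"
  shows "op_exp (Y1 d + Y2 d) = exp (- \<i> * pi * h / 2) *\<^sub>C (op_exp (Y1 d) * op_exp (Y2 d))"
    "op_exp (Y1 d + Y2 d) = exp (\<i> * pi * h / 2) *\<^sub>C (op_exp (Y2 d) * op_exp (Y1 d))"
proof -
  have *: "op_exp (Y1 d) = shear_exp d 1 0 0" "op_exp (Y2 d) = shear_exp d 0 1 0" "op_exp (Y1 d + Y2 d) = shear_exp d 1 1 0"
    by (simp_all add: shear_exp_def shear_lin_def cscale_one)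
  show "op_exp (Y1 d + Y2 d) = exp (- \<i> * pi * h / 2) *\<^sub>C (op_exp (Y1 d) * op_exp (Y2 d))"
    "op_exp (Y1 d + Y2 d) = exp (\<i> * pi * h / 2) *\<^sub>C (op_exp (Y2 d) * op_exp (Y1 d))"
    unfolding * by (simp_all add: shear_exp_mult[OF d] q_pow_def cscale_cscale cscale_one flip: exp_add)
qed

lemma hermitian_mult: "hermitian A \<Longrightarrow> hermitian B \<Longrightarrow> A * B = B * A \<Longrightarrow> hermitian (A * B)"
  unfolding hermitian_iff_adjoint_op by (metis adjoint_op_mult)

lemma commute_mult: "x * y = y * x \<Longrightarrow> x * z = z * x \<Longrightarrow> x * (y * z) = (y * z) * x"
  for x y z :: "'a::semigroup_mult"
  by (metis mult.assoc)

lemma cnj_q_pow: "cnj (q_pow h s) = q_pow h (- s)"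
  by (simp add: q_pow_def exp_cnj)

text \<open>By \<open>casimir_eq\<close> this is a sum of products of commuting Hermitian operators,
  plus a constant that is real because conjugation swaps the two powers of \<open>q\<close>.\<close>

lemma hermitian_casimir:
  assumes d: "d \<in> quantum_shear h"
  shows "hermitian (casimir h d)"
proof -
  have G: "hermitian (G1 d)" "hermitian (G2 d)" "hermitian (G3 d)" "hermitian (Ginf d)"
    using central_commute(1)[OF d] hermitian_geodesics(4)[OF d] by auto
  note C = central_Ginf[OF d]
  have C': "G1 d * G2 d = G2 d * G1 d" "G1 d * G3 d = G3 d * G1 d" "G2 d * G3 d = G3 d * G2 d"
    by (rule central_commute[OF d]; simp)+
  have "hermitian (G3 d * Ginf d)"
    by (rule hermitian_mult[OF G(3,4) C(3)])
  then have "hermitian (G2 d * (G3 d * Ginf d))"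
    by (rule hermitian_mult[OF G(2)]) (rule commute_mult[OF C'(3) C(2)])
  then have "hermitian (G1 d * (G2 d * (G3 d * Ginf d)))"
    by (rule hermitian_mult[OF G(1)]) (rule commute_mult[OF C'(1) commute_mult[OF C'(2) C(1)]])
  moreover have "hermitian ((- (q_pow h 1 + q_pow h (-1) + 2)) *\<^sub>C 1)"
  proof -
    have "cnj (- (q_pow h 1 + q_pow h (-1) + 2)) = - (q_pow h 1 + q_pow h (-1) + 2)"
      by (simp add: cnj_q_pow)
    then show ?thesis
      unfolding hermitian_iff_adjoint_op
      using adjoint_op_scaleC[OF adjoint_op_one, of "- (q_pow h 1 + q_pow h (-1) + 2)"] by metis
  qed
  ultimately have "hermitian (G1 d * G1 d + G2 d * G2 d + G3 d * G3 d + Ginf d * Ginf d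
      + G1 d * (G2 d * (G3 d * Ginf d)) + (- (q_pow h 1 + q_pow h (-1) + 2)) *\<^sub>C 1)"
    using hermitian_mult[OF G(1) G(1)] hermitian_mult[OF G(2) G(2)] hermitian_mult[OF G(3) G(3)]
      hermitian_mult[OF G(4) G(4)] by (intro hermitian_add) simp_all
  then show ?thesis
    unfolding casimir_eq[OF d] cscale_minus_left by simp
qed

lemma generated_algebra_central:
  fixes z :: "'a::complex_algebra"
  assumes "X \<in> generated_algebra u S" and "z * u = u * z" and "\<And>x. x \<in> S \<Longrightarrow> z * x = x * z"
  shows "z * X = X * z"
  using assms(1)
proof (induction rule: generated_algebra.induct)
  case (mult x y)
  then show ?case by (metis mult.assoc)
qed (use assms in \<open>simp_all add: distrib_left distrib_right cscale_mult_left cscale_mult_right\<close>)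

lemma generated_algebra_diff:
  fixes x y :: "'a::complex_algebra"
  shows "x \<in> generated_algebra u S \<Longrightarrow> y \<in> generated_algebra u S \<Longrightarrow> x - y \<in> generated_algebra u S"
  using generated_algebra.add[OF _ generated_algebra.scale[of y u S "-1"], of x]
  by (simp add: cscale_minus_left cscale_one)

lemma algebra_endomorphism_comp:
  assumes "algebra_endomorphism u A \<beta>" "algebra_endomorphism u A \<gamma>"
  shows "algebra_endomorphism u A (\<beta> \<circ> \<gamma>)"
  unfolding algebra_endomorphism_def comp_def
  by (simp add: algebra_endomorphismD[OF assms(1)] algebra_endomorphismD[OF assms(2)])

lemma algebra_endomorphism_diff:
  fixes x y :: "'a::complex_algebra"
  assumes \<beta>: "algebra_endomorphism u (generated_algebra u S) \<beta>"
    and x: "x \<in> generated_algebra u S" and y: "y \<in> generated_algebra u S"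
  shows "\<beta> (x - y) = \<beta> x - \<beta> y"
proof -
  have "\<beta> (x + (-1) *\<^sub>C y) = \<beta> x + (-1) *\<^sub>C \<beta> y"
    using algebra_endomorphismD(3,5)[OF \<beta>] x y generated_algebra.scale[OF y] by metis
  then show ?thesis
    by (simp add: cscale_minus_left cscale_one)
qed

lemma algebra_endomorphism_eqI:
  assumes "algebra_endomorphism u (generated_algebra u S) \<beta>" "algebra_endomorphism u (generated_algebra u S) \<gamma>"
    and "\<And>x. x \<in> S \<Longrightarrow> \<beta> x = \<gamma> x" and "x \<in> generated_algebra u S"
  shows "\<beta> x = \<gamma> x"
  using assms(4)
  by (induction rule: generated_algebra.induct)
    (simp_all add: assms(3) algebra_endomorphismD[OF assms(1)] algebra_endomorphismD[OF assms(2)])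

text \<open>The braid relation turns the third power of \<open>c\<close> after \<open>b\<close> into
  that of \<open>b\<close> after \<open>c\<close>, so both are the identity. Removing an outer
  factor from one and an inner factor from the other leaves a two-sided inverse.\<close>

lemma braid_pair_bij:
  assumes b: "\<And>x. x \<in> A \<Longrightarrow> b x \<in> A" and c: "\<And>x. x \<in> A \<Longrightarrow> c x \<in> A"
    and braid: "\<And>x. x \<in> A \<Longrightarrow> b (c (b x)) = c (b (c x))"
    and order: "\<And>x. x \<in> A \<Longrightarrow> b (c (b (c (b (c x))))) = x"
  shows "bij_betw b A A" "bij_betw c A A"
proof -
  have order': "c (b (c (b (c (b x))))) = x" if "x \<in> A" for x
  proof -
    have "c (b (c (b (c (b x))))) = c (b (c (c (b (c x)))))"
      by (simp only: braid[OF that])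
    also have "\<dots> = b (c (b (c (b (c x)))))"
      using braid[of "c (b (c x))"] that b c by simp
    finally show ?thesis using order that by simp
  qed
  show "bij_betw b A A"
    by (rule bij_betwI[where g = "\<lambda>x. c (b (c (b (c x))))"]) (use b c order order' in auto)
  show "bij_betw c A A"
    by (rule bij_betwI[where g = "\<lambda>x. b (c (b (c (b x))))"]) (use b c order order' in auto)
qed

theorem mainTheorem5:
  fixes h :: real and d :: "'d::complex_inner shear_data" and q :: "real \<Rightarrow> complex"
  assumes d: "d \<in> quantum_shear h"
    and q: "q = q_pow h"
  shows
    "(\<forall>A \<in> {Y1 d, Y2 d, Y3 d}. \<forall>B \<in> {Y1 d, Y2 d, Y3 d}. \<forall>a b.
        op_exp (a *\<^sub>C A) * op_exp (b *\<^sub>C B)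
          = op_exp (a *\<^sub>C A + b *\<^sub>C B + (a * b / 2) *\<^sub>C (A * B - B * A)))
     \<and> op_exp (Y1 d + Y2 d) = exp (- \<i> * pi * h / 2) *\<^sub>C (op_exp (Y1 d) * op_exp (Y2 d))
     \<and> op_exp (Y1 d + Y2 d) = exp (\<i> * pi * h / 2) *\<^sub>C (op_exp (Y2 d) * op_exp (Y1 d))
     \<and> hermitian (G12 d) \<and> hermitian (G23 d) \<and> hermitian (G13 d)

     \<and> q (- 1/2) *\<^sub>C (G12 d * G23 d) - q (1/2) *\<^sub>C (G23 d * G12 d)
        = (q (- 1) - q 1) *\<^sub>C G13 d + (q (- 1/2) - q (1/2)) *\<^sub>C omega13 d
     \<and> q (- 1/2) *\<^sub>C (G23 d * G13 d) - q (1/2) *\<^sub>C (G13 d * G23 d)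
        = (q (- 1) - q 1) *\<^sub>C G12 d + (q (- 1/2) - q (1/2)) *\<^sub>C omega12 d
     \<and> q (- 1/2) *\<^sub>C (G13 d * G12 d) - q (1/2) *\<^sub>C (G12 d * G13 d)
        = (q (- 1) - q 1) *\<^sub>C G23 d + (q (- 1/2) - q (1/2)) *\<^sub>C omega23 d

     \<and> (\<exists>\<beta>12 \<beta>23 :: ('d shear_data \<Rightarrow> 'd operator) \<Rightarrow> ('d shear_data \<Rightarrow> 'd operator).
       algebra_automorphism (obs h 1) (geodesic_algebra h) \<beta>12
     \<and> algebra_automorphism (obs h 1) (geodesic_algebra h) \<beta>23
     \<and> \<beta>12 (obs h G1) = obs h G2 \<and> \<beta>12 (obs h G2) = obs h G1
     \<and> \<beta>12 (obs h G3) = obs h G3 \<and> \<beta>12 (obs h Ginf) = obs h Ginf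
     \<and> \<beta>23 (obs h G2) = obs h G3 \<and> \<beta>23 (obs h G3) = obs h G2
     \<and> \<beta>23 (obs h G1) = obs h G1 \<and> \<beta>23 (obs h Ginf) = obs h Ginf

     \<and> \<beta>12 (obs h G12) = obs h G12
     \<and> \<beta>12 (obs h G23) = obs h G13
     \<and> \<beta>12 (obs h G13)
         = q (1/2) *\<^sub>C (obs h G12 * obs h G13) - q 1 *\<^sub>C obs h G23 - q (1/2) *\<^sub>C obs h omega23
     \<and> \<beta>12 (obs h G13)
         = q (- 1/2) *\<^sub>C (obs h G13 * obs h G12) - q (- 1) *\<^sub>C obs h G23
           - q (- 1/2) *\<^sub>C obs h omega23
     \<and> \<beta>12 (obs h omega12) = obs h omega12
     \<and> \<beta>12 (obs h omega23) = obs h omega13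
     \<and> \<beta>12 (obs h omega13) = obs h omega23

     \<and> \<beta>23 (obs h G12)
         = q (1/2) *\<^sub>C (obs h G23 * obs h G12) - q 1 *\<^sub>C obs h G13 - q (1/2) *\<^sub>C obs h omega13
     \<and> \<beta>23 (obs h G12)
         = q (- 1/2) *\<^sub>C (obs h G12 * obs h G23) - q (- 1) *\<^sub>C obs h G13
           - q (- 1/2) *\<^sub>C obs h omega13
     \<and> \<beta>23 (obs h G23) = obs h G23
     \<and> \<beta>23 (obs h G13) = obs h G12
     \<and> \<beta>23 (obs h omega12) = obs h omega13
     \<and> \<beta>23 (obs h omega23) = obs h omega23
     \<and> \<beta>23 (obs h omega13) = obs h omega12

     \<and> (\<forall>X \<in> geodesic_algebra h. \<beta>12 (\<beta>23 (\<beta>12 X)) = \<beta>23 (\<beta>12 (\<beta>23 X)))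
     \<and> (\<forall>X \<in> geodesic_algebra h. ((\<beta>12 \<circ> \<beta>23) ^^ 3) X = X))

     \<and> (\<forall>w \<in> {omega12, omega23, omega13}.
          \<forall>X \<in> (geodesic_algebra h :: ('d shear_data \<Rightarrow> 'd operator) set). obs h w * X = X * obs h w)
     \<and> obs h (casimir h) \<in> (geodesic_algebra h :: ('d shear_data \<Rightarrow> 'd operator) set)
     \<and> (\<forall>X \<in> (geodesic_algebra h :: ('d shear_data \<Rightarrow> 'd operator) set).
          obs h (casimir h) * X = X * obs h (casimir h))
     \<and> hermitian (casimir h d)"
proof -
  let ?A = "geodesic_algebra h :: ('d shear_data \<Rightarrow> 'd operator) set"
  let ?u = "obs h 1 :: 'd shear_data \<Rightarrow> 'd operator"
  let ?p = "q_pow h (1/2)" and ?r = "q_pow h (- 1/2)"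
  let ?X = "obs h G12 :: 'd shear_data \<Rightarrow> 'd operator"
  let ?Y = "obs h G23 :: 'd shear_data \<Rightarrow> 'd operator"
  let ?Z = "obs h G13 :: 'd shear_data \<Rightarrow> 'd operator"
  let ?g1 = "obs h G1 :: 'd shear_data \<Rightarrow> 'd operator"
  let ?g2 = "obs h G2 :: 'd shear_data \<Rightarrow> 'd operator"
  let ?g3 = "obs h G3 :: 'd shear_data \<Rightarrow> 'd operator"
  let ?e = "obs h Ginf :: 'd shear_data \<Rightarrow> 'd operator"
  interpret O: four_holed_algebra ?p ?r ?u ?X ?Y ?Z ?g1 ?g2 ?g3 ?e
    by (rule four_holed_algebra_obs)
  define Z' where "Z' = ?p *\<^sub>C (?X * ?Z) - (?p * ?p) *\<^sub>C ?Y - ?p *\<^sub>C (?g2 * ?g3 + ?g1 * ?e)"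
  define X' where "X' = ?p *\<^sub>C (?Y * ?X) - (?p * ?p) *\<^sub>C ?Z - ?p *\<^sub>C (?g1 * ?g3 + ?g2 * ?e)"
  have Z'_alt: "Z' = ?r *\<^sub>C (?Z * ?X) - (?r * ?r) *\<^sub>C ?Y - ?r *\<^sub>C (?g2 * ?g3 + ?g1 * ?e)"
    unfolding Z'_def by (rule O.braid_generator_alt)
  have X'_alt: "X' = ?r *\<^sub>C (?X * ?Y) - (?r * ?r) *\<^sub>C ?Z - ?r *\<^sub>C (?g1 * ?g3 + ?g2 * ?e)"
    unfolding X'_def by (rule O.braid_generator_alt)
  have gens: "?u \<in> ?A" "?X \<in> ?A" "?Y \<in> ?A" "?Z \<in> ?A" "?g1 \<in> ?A" "?g2 \<in> ?A" "?g3 \<in> ?A" "?e \<in> ?A"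
    unfolding geodesic_algebra_eq by (rule generated_algebra.unit, (rule generated_algebra.generator, blast)+)
  note closed = generated_algebra.add[of _ ?u "geodesic_generators h", folded geodesic_algebra_eq]
    generated_algebra.mult[of _ ?u "geodesic_generators h", folded geodesic_algebra_eq]
    generated_algebra.scale[of _ ?u "geodesic_generators h", folded geodesic_algebra_eq]
    generated_algebra_diff[of _ ?u "geodesic_generators h", folded geodesic_algebra_eq]
  have X'A: "X' \<in> ?A" and Z'A: "Z' \<in> ?A"
    unfolding X'_def Z'_def by (intro closed gens)+
  obtain b where b: "algebra_endomorphism ?u ?A b" and b_gens: "b ?X = ?X" "b ?Y = ?Z" "b ?Z = Z'"
    "b ?g1 = ?g2" "b ?g2 = ?g1" "b ?g3 = ?g3" "b ?e = ?e"
    by (rule geodesic_algebra_hom_exists[OF d O.four_holed_algebra_braid[folded Z'_def]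
          gens(2) gens(4) Z'A gens(6) gens(5) gens(7) gens(8)])
  obtain c where c: "algebra_endomorphism ?u ?A c" and c_gens: "c ?X = X'" "c ?Y = ?Y" "c ?Z = ?X"
    "c ?g1 = ?g1" "c ?g2 = ?g3" "c ?g3 = ?g2" "c ?e = ?e"
    by (rule geodesic_algebra_hom_exists[OF d O.four_holed_algebra_braid'[folded X'_def]
          X'A gens(3) gens(2) gens(5) gens(7) gens(6) gens(8)])
  note diff = algebra_endomorphism_diff[where u = ?u and S = "geodesic_generators h", folded geodesic_algebra_eq]
  note hom_b = algebra_endomorphismD[OF b] diff[OF b]
  note hom_c = algebra_endomorphismD[OF c] diff[OF c]
  have bX': "b X' = ?Y"
  proof -
    have "b X' = ?p *\<^sub>C (?Z * ?X) - (?p * ?p) *\<^sub>C Z' - ?p *\<^sub>C (?g2 * ?g3 + ?g1 * ?e)"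
      unfolding X'_def by (simp add: hom_b b_gens gens closed)
    also have "\<dots> = ?Y"
      unfolding Z'_def by (rule O.braid_generator_inverse)
    finally show ?thesis .
  qed
  have cZ': "c Z' = ?p *\<^sub>C (X' * ?X) - (?p * ?p) *\<^sub>C ?Y - ?p *\<^sub>C (?g3 * ?g2 + ?g1 * ?e)"
    unfolding Z'_def by (simp add: hom_c c_gens gens closed)
  \<comment> \<open>The value needed for the braid relation at \<open>?Z\<close>, where the other
    order gives \<open>c (b (c ?Z)) = c (b ?X) = X'\<close>.\<close>
  have bcZ': "b (c Z') = X'"
    unfolding cZ' by (simp add: hom_b b_gens bX' gens closed X'A) (simp add: X'_def O.central)
  note eqI = algebra_endomorphism_eqI[where u = ?u and S = "geodesic_generators h", folded geodesic_algebra_eq]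
  have braid: "b (c (b x)) = c (b (c x))" if "x \<in> ?A" for x
  proof -
    have "(b \<circ> (c \<circ> b)) x = (c \<circ> (b \<circ> c)) x"
    proof (rule eqI[where \<beta> = "b \<circ> (c \<circ> b)" and \<gamma> = "c \<circ> (b \<circ> c)"])
      show "(b \<circ> (c \<circ> b)) y = (c \<circ> (b \<circ> c)) y" if "y \<in> geodesic_generators h" for y
        using that by (auto simp: b_gens c_gens bX' bcZ')
    qed (intro algebra_endomorphism_comp b c that)+
    then show ?thesis by simp
  qed
  \<comment> \<open>\<open>b\<close> after \<open>c\<close> rotates \<open>?X\<close>,
    \<open>?Y\<close>, \<open>?Z\<close> and \<open>?g1\<close>, \<open>?g2\<close>,
    \<open>?g3\<close> cyclically and fixes \<open>?e\<close>; its cube therefore fixes all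
    generators.\<close>
  have order: "b (c (b (c (b (c x))))) = x" if "x \<in> ?A" for x
  proof -
    have "(b \<circ> (c \<circ> (b \<circ> (c \<circ> (b \<circ> c))))) x = id x"
    proof (rule eqI[where \<beta> = "b \<circ> (c \<circ> (b \<circ> (c \<circ> (b \<circ> c))))" and \<gamma> = id])
      show "(b \<circ> (c \<circ> (b \<circ> (c \<circ> (b \<circ> c))))) y = id y" if "y \<in> geodesic_generators h" for y
        using that by (auto simp: b_gens c_gens bX')
      show "algebra_endomorphism ?u ?A id"
        by (simp add: algebra_endomorphism_def)
    qed (intro algebra_endomorphism_comp b c that)+
    then show ?thesis by simp
  qed
  have bij: "bij_betw b ?A ?A" "bij_betw c ?A ?A"
    by (rule braid_pair_bij[of ?A b c]; use hom_b(2) hom_c(2) braid order in blast)+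
  have auto: "algebra_automorphism ?u ?A b" "algebra_automorphism ?u ?A c"
    using b c bij unfolding algebra_automorphism_def algebra_endomorphism_def by blast+
  have omega_b: "b (obs h omega12) = obs h omega12" "b (obs h omega23) = obs h omega13" "b (obs h omega13) = obs h omega23"
    unfolding obs_omega by (simp_all add: hom_b b_gens gens closed O.central)
  have omega_c: "c (obs h omega12) = obs h omega13" "c (obs h omega23) = obs h omega23" "c (obs h omega13) = obs h omega12"
    unfolding obs_omega by (simp_all add: hom_c c_gens gens closed O.central)
  have q2: "?p * ?p = q_pow h 1" "?r * ?r = q_pow h (- 1)"
    by (simp_all add: q_pow_add)
  have Z': "b ?Z = ?p *\<^sub>C (?X * ?Z) - q_pow h 1 *\<^sub>C ?Y - ?p *\<^sub>C obs h omega23"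
    "b ?Z = ?r *\<^sub>C (?Z * ?X) - q_pow h (- 1) *\<^sub>C ?Y - ?r *\<^sub>C obs h omega23"
    unfolding b_gens obs_omega q2[symmetric] by (rule Z'_def Z'_alt)+
  have X': "c ?X = ?p *\<^sub>C (?Y * ?X) - q_pow h 1 *\<^sub>C ?Z - ?p *\<^sub>C obs h omega13"
    "c ?X = ?r *\<^sub>C (?X * ?Y) - q_pow h (- 1) *\<^sub>C ?Z - ?r *\<^sub>C obs h omega13"
    unfolding c_gens obs_omega q2[symmetric] by (rule X'_def X'_alt)+
  have order3: "((b \<circ> c) ^^ 3) x = x" if "x \<in> ?A" for x
    using order[OF that] by (simp add: numeral_3_eq_3)
  have central: "z * x = x * z" if "x \<in> ?A" "z * ?u = ?u * z" "\<And>y. y \<in> geodesic_generators h \<Longrightarrow> z * y = y * z"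
    for z x :: "'d shear_data \<Rightarrow> 'd operator"
    using generated_algebra_central[OF that(1)[unfolded geodesic_algebra_eq]] that(2,3) by blast
  have omega_central: "obs h w * x = x * obs h w" if "w \<in> {omega12, omega23, omega13}" "x \<in> ?A" for w x
    by (rule central[OF that(2)])
      (use that(1) in \<open>auto simp: obs_omega distrib_left distrib_right mult.assoc O.unit O.unit[THEN O.mult_left_rule] O.central O.central_left\<close>)
  \<comment> \<open>As a polynomial in central generators the Casimir observable visibly lies in the
    algebra and commutes with it.\<close>
  have cas: "obs h (casimir h) = ?g1 * ?g1 + ?g2 * ?g2 + ?g3 * ?g3 + ?e * ?e
      + ?g1 * (?g2 * (?g3 * ?e)) - (q_pow h 1 + q_pow h (-1) + 2) *\<^sub>C ?u"
  proof
    fix d' :: "'d shear_data"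
    show "obs h (casimir h) d' = (?g1 * ?g1 + ?g2 * ?g2 + ?g3 * ?g3 + ?e * ?e
      + ?g1 * (?g2 * (?g3 * ?e)) - (q_pow h 1 + q_pow h (-1) + 2) *\<^sub>C ?u) d'"
      by (cases "d' \<in> quantum_shear h") (simp_all add: casimir_eq obs_out)
  qed
  have cas_in: "obs h (casimir h) \<in> ?A"
    unfolding cas by (intro closed gens)
  have cas_central: "obs h (casimir h) * x = x * obs h (casimir h)" if "x \<in> ?A" for x
    by (rule central[OF that])
      (auto simp: cas O.expand_simps)
  have braids: "(\<exists>\<beta>12 \<beta>23 :: ('d shear_data \<Rightarrow> 'd operator) \<Rightarrow> ('d shear_data \<Rightarrow> 'd operator).
       algebra_automorphism (obs h 1) (geodesic_algebra h) \<beta>12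
     \<and> algebra_automorphism (obs h 1) (geodesic_algebra h) \<beta>23
     \<and> \<beta>12 (obs h G1) = obs h G2 \<and> \<beta>12 (obs h G2) = obs h G1
     \<and> \<beta>12 (obs h G3) = obs h G3 \<and> \<beta>12 (obs h Ginf) = obs h Ginf
     \<and> \<beta>23 (obs h G2) = obs h G3 \<and> \<beta>23 (obs h G3) = obs h G2
     \<and> \<beta>23 (obs h G1) = obs h G1 \<and> \<beta>23 (obs h Ginf) = obs h Ginf

     \<and> \<beta>12 (obs h G12) = obs h G12
     \<and> \<beta>12 (obs h G23) = obs h G13
     \<and> \<beta>12 (obs h G13)
         = q (1/2) *\<^sub>C (obs h G12 * obs h G13) - q 1 *\<^sub>C obs h G23 - q (1/2) *\<^sub>C obs h omega23
     \<and> \<beta>12 (obs h G13)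
         = q (- 1/2) *\<^sub>C (obs h G13 * obs h G12) - q (- 1) *\<^sub>C obs h G23
           - q (- 1/2) *\<^sub>C obs h omega23
     \<and> \<beta>12 (obs h omega12) = obs h omega12
     \<and> \<beta>12 (obs h omega23) = obs h omega13
     \<and> \<beta>12 (obs h omega13) = obs h omega23

     \<and> \<beta>23 (obs h G12)
         = q (1/2) *\<^sub>C (obs h G23 * obs h G12) - q 1 *\<^sub>C obs h G13 - q (1/2) *\<^sub>C obs h omega13
     \<and> \<beta>23 (obs h G12)
         = q (- 1/2) *\<^sub>C (obs h G12 * obs h G23) - q (- 1) *\<^sub>C obs h G13
           - q (- 1/2) *\<^sub>C obs h omega13
     \<and> \<beta>23 (obs h G23) = obs h G23
     \<and> \<beta>23 (obs h G13) = obs h G12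
     \<and> \<beta>23 (obs h omega12) = obs h omega13
     \<and> \<beta>23 (obs h omega23) = obs h omega23
     \<and> \<beta>23 (obs h omega13) = obs h omega12

     \<and> (\<forall>X \<in> geodesic_algebra h. \<beta>12 (\<beta>23 (\<beta>12 X)) = \<beta>23 (\<beta>12 (\<beta>23 X)))
     \<and> (\<forall>X \<in> geodesic_algebra h. ((\<beta>12 \<circ> \<beta>23) ^^ 3) X = X))"
    unfolding q
    by (intro exI[of _ b] exI[of _ c] conjI ballI)
      (rule auto b_gens c_gens omega_b omega_c braid order3 Z' X'; assumption?)+
  show ?thesis
    using op_exp_shear_coordinates[OF d] weyl_ordering[OF d] hermitian_geodesics[OF d]
      commutation_G12_G23[OF d] commutation_G23_G13[OF d] commutation_G13_G12[OF d]
      braids omega_central cas_in cas_central hermitian_casimir[OF d]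
    unfolding q by (intro conjI ballI allI) blast+
qed

end
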